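(* Let $H$ be a cocommutative Hopf algebra and let $X$ be a coalgebra on which $H$ acts (on the right), such that the action is compatible with the comultiplication of $X$. Suppose $X$ is a categorical augmented rack with augmentation map $\nu:X\to H$ (in particular $\nu$ is a coalgebra morphism). Let $Y:=X\otimes X$ with comultiplication $\Delta_Y:=(\mathbb{1}\otimes\tau\otimes\mathbb{1})(\Delta_X\otimes\Delta_X)$, right $H$-action $(x_1\otimes x_2)\cdot h=(x_1\cdot h^{(1)})\otimes(x_2\cdot h^{(2)})$, and map $\tilde\nu:=\mu(\nu\otimes\nu):Y\to H$, where $\mu$ is the multiplication of $H$. Then the associated R-matrix $R:Y\otimes Y\to Y\otimes Y$, given by $R(u\otimes v)=v^{(1)}\otimes\bigl(u\cdot\tilde\nu(v^{(2)})\bigr)$ for $u,v\in Y$ (where $\Delta_Y(v)=v^{(1)}\otimes v^{(2)}$), satisfies the Yang-Baxter equation $$(R\otimes\mathbb{1})(\mathbb{1}\otimes R)(R\otimes\mathbb{1})=(\mathbb{1}\otimes R)(R\otimes\mathbb{1})(\mathbb{1}\otimes R).$$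
   Context: Everything is over a commutative unital ring $\mathbb{k}$; tensor products are over $\mathbb{k}$, $\mathbb{1}$ is the identity map, and $\tau(x\otimes y)=y\otimes x$. A Hopf algebra $H$ has multiplication $\mu$ (written as juxtaposition), unit $\eta$, comultiplication $\Delta_H$, counit $\epsilon$ and antipode $S$. Coalgebras are coassociative and counital; Sweedler notation $\Delta(x)=x^{(1)}\otimes x^{(2)}$ is used with summation suppressed. Categorical augmented rack: let $H$ be a Hopf algebra and let $X$ be a coalgebra (comultiplication $\Delta_X$) that is a right $H$-module with action $x\otimes g\mapsto x\cdot g$, such that the action is compatible with the comultiplication: $\Delta_X(x\cdot g)=(x^{(1)}\cdot g^{(1)})\otimes(x^{(2)}\cdot g^{(2)})$ for all $x\in X$, $g\in H$. An augmentation map is a linear map $\nu:X\to H$ that is a coalgebra morphism, meaning $\Delta_H(\nu(x))=(\nu\otimes\nu)(\Delta_X(x))$ for all $x\in X$, and satisfies $\nu(x\cdot g)=S(g^{(1)})\,\nu(x)\,g^{(2)}$ for all $x\in X$, $g\in H$. If such a $\nu$ is given, $X$ is called a categorical augmented rack (over $H$, with augmentation map $\nu$). *)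

theory Defs
  imports "HOL-Algebra.Module" "HOL-Algebra.AbelCoset"
begin

section \<open>Modules and tensor products over a commutative ring\<close>

definition linear_maps ::
  "('k, 'r) ring_scheme \<Rightarrow> ('k, 'a, 'm) module_scheme \<Rightarrow> ('k, 'b, 'n) module_scheme \<Rightarrow> ('a \<Rightarrow> 'b) set"
  where "linear_maps K M N =
    {f \<in> carrier M \<rightarrow> carrier N.
      (\<forall>x\<in>carrier M. \<forall>y\<in>carrier M. f (x \<oplus>\<^bsub>M\<^esub> y) = f x \<oplus>\<^bsub>N\<^esub> f y) \<and>
      (\<forall>r\<in>carrier K. \<forall>x\<in>carrier M. f (r \<odot>\<^bsub>M\<^esub> x) = r \<odot>\<^bsub>N\<^esub> f x)}"

definition bilinear_map ::
  "('k, 'r) ring_scheme \<Rightarrow> ('k, 'a, 'm) module_scheme \<Rightarrow> ('k, 'b, 'n) module_scheme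
    \<Rightarrow> ('k, 'c, 'p) module_scheme \<Rightarrow> ('a \<Rightarrow> 'b \<Rightarrow> 'c) \<Rightarrow> bool"
  where "bilinear_map K M N P B \<longleftrightarrow>
    (\<forall>x\<in>carrier M. (\<lambda>y. B x y) \<in> linear_maps K N P) \<and>
    (\<forall>y\<in>carrier N. (\<lambda>x. B x y) \<in> linear_maps K M P)"

definition ring_as_module :: "('k, 'r) ring_scheme \<Rightarrow> ('k, 'k) module"
  where "ring_as_module K =
    \<lparr>carrier = carrier K, mult = mult K, one = one K, zero = zero K, add = add K, smult = mult K\<rparr>"

text \<open>
  The fields \<open>mult\<close> and \<open>one\<close> of a module record play no role for plain modules and are left
  unspecified in the constructions below.
\<close>

definition free_module :: "('k, 'r) ring_scheme \<Rightarrow> 'a set \<Rightarrow> ('k, 'a \<Rightarrow> 'k) module"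
  where "free_module K A =
    \<lparr>carrier = {p. range p \<subseteq> carrier K \<and> finite {t. p t \<noteq> \<zero>\<^bsub>K\<^esub>} \<and> {t. p t \<noteq> \<zero>\<^bsub>K\<^esub>} \<subseteq> A},
     mult = undefined, one = undefined,
     zero = (\<lambda>_. \<zero>\<^bsub>K\<^esub>), add = (\<lambda>p q t. p t \<oplus>\<^bsub>K\<^esub> q t), smult = (\<lambda>r p t. r \<otimes>\<^bsub>K\<^esub> p t)\<rparr>"

definition free_gen :: "('k, 'r) ring_scheme \<Rightarrow> 'a \<Rightarrow> 'a \<Rightarrow> 'k"
  where "free_gen K t = (\<lambda>s. if s = t then \<one>\<^bsub>K\<^esub> else \<zero>\<^bsub>K\<^esub>)"

definition tensor_relators ::
  "('k, 'r) ring_scheme \<Rightarrow> ('k, 'a, 'm) module_scheme \<Rightarrow> ('k, 'b, 'n) module_scheme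
    \<Rightarrow> ('a \<times> 'b \<Rightarrow> 'k) set"
  where "tensor_relators K M N = (let F = free_module K (carrier M \<times> carrier N) in
     {free_gen K (x \<oplus>\<^bsub>M\<^esub> x', y) \<ominus>\<^bsub>F\<^esub> (free_gen K (x, y) \<oplus>\<^bsub>F\<^esub> free_gen K (x', y)) | x x' y.
        x \<in> carrier M \<and> x' \<in> carrier M \<and> y \<in> carrier N} \<union>
     {free_gen K (x, y \<oplus>\<^bsub>N\<^esub> y') \<ominus>\<^bsub>F\<^esub> (free_gen K (x, y) \<oplus>\<^bsub>F\<^esub> free_gen K (x, y')) | x y y'.
        x \<in> carrier M \<and> y \<in> carrier N \<and> y' \<in> carrier N} \<union>
     {free_gen K (r \<odot>\<^bsub>M\<^esub> x, y) \<ominus>\<^bsub>F\<^esub> (r \<odot>\<^bsub>F\<^esub> free_gen K (x, y)) | r x y.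
        r \<in> carrier K \<and> x \<in> carrier M \<and> y \<in> carrier N} \<union>
     {free_gen K (x, r \<odot>\<^bsub>N\<^esub> y) \<ominus>\<^bsub>F\<^esub> (r \<odot>\<^bsub>F\<^esub> free_gen K (x, y)) | r x y.
        r \<in> carrier K \<and> x \<in> carrier M \<and> y \<in> carrier N})"

definition tensor_kernel ::
  "('k, 'r) ring_scheme \<Rightarrow> ('k, 'a, 'm) module_scheme \<Rightarrow> ('k, 'b, 'n) module_scheme
    \<Rightarrow> ('a \<times> 'b \<Rightarrow> 'k) set"
  where "tensor_kernel K M N =
    \<Inter>{S. submodule S K (free_module K (carrier M \<times> carrier N)) \<and> tensor_relators K M N \<subseteq> S}"

text \<open>
  The tensor product is the quotient of the free module on \<open>carrier M \<times> carrier N\<close> by the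
  submodule generated by the bilinearity relations; its elements are cosets.
\<close>

definition tensor ::
  "('k, 'r) ring_scheme \<Rightarrow> ('k, 'a, 'm) module_scheme \<Rightarrow> ('k, 'b, 'n) module_scheme
    \<Rightarrow> ('k, ('a \<times> 'b \<Rightarrow> 'k) set) module"
  where "tensor K M N =
    (let F = free_module K (carrier M \<times> carrier N); L = tensor_kernel K M N in
     \<lparr>carrier = a_rcosets\<^bsub>F\<^esub> L, mult = undefined, one = undefined,
      zero = L, add = set_add F, smult = (\<lambda>r Z. \<Union>p\<in>Z. L +>\<^bsub>F\<^esub> (r \<odot>\<^bsub>F\<^esub> p))\<rparr>)"

definition pure_tensor ::
  "('k, 'r) ring_scheme \<Rightarrow> ('k, 'a, 'm) module_scheme \<Rightarrow> ('k, 'b, 'n) module_scheme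
    \<Rightarrow> 'a \<Rightarrow> 'b \<Rightarrow> ('a \<times> 'b \<Rightarrow> 'k) set"
  where "pure_tensor K M N x y =
    tensor_kernel K M N +>\<^bsub>free_module K (carrier M \<times> carrier N)\<^esub> free_gen K (x, y)"

text \<open>
  \<open>tensor_lift K P B\<close> is the linear map into \<open>P\<close> sending \<open>x \<otimes> y\<close> to \<open>B x y\<close>, for a bilinear \<open>B\<close>:
  bilinearity makes the linear extension of \<open>B\<close> to the free module constant on every coset.
  Since \<open>tensor_lift K P (\<lambda>x\<^sub>1 x\<^sub>2. B x\<^sub>1 x\<^sub>2) (\<Delta> x)\<close> is the sum of the \<open>B x\<^sup>(\<^sup>1\<^sup>) x\<^sup>(\<^sup>2\<^sup>)\<close>, it also
  renders Sweedler notation.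
\<close>

definition tensor_lift ::
  "('k, 'r) ring_scheme \<Rightarrow> ('k, 'c, 'p) module_scheme \<Rightarrow> ('a \<Rightarrow> 'b \<Rightarrow> 'c)
    \<Rightarrow> ('a \<times> 'b \<Rightarrow> 'k) set \<Rightarrow> 'c"
  where "tensor_lift K P B Z =
    the_elem ((\<lambda>p. \<Oplus>\<^bsub>P\<^esub>t\<in>{t. p t \<noteq> \<zero>\<^bsub>K\<^esub>}. p t \<odot>\<^bsub>P\<^esub> case_prod B t) ` Z)"

text \<open>\<open>f \<otimes> g\<close> for linear maps into \<open>M'\<close> and \<open>N'\<close>\<close>

definition tensor_map ::
  "('k, 'r) ring_scheme \<Rightarrow> ('k, 'c, 'm) module_scheme \<Rightarrow> ('k, 'd, 'n) module_scheme
    \<Rightarrow> ('a \<Rightarrow> 'c) \<Rightarrow> ('b \<Rightarrow> 'd) \<Rightarrow> ('a \<times> 'b \<Rightarrow> 'k) set \<Rightarrow> ('c \<times> 'd \<Rightarrow> 'k) set"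
  where "tensor_map K M' N' f g =
    tensor_lift K (tensor K M' N') (\<lambda>x y. pure_tensor K M' N' (f x) (g y))"

text \<open>\<open>\<tau> : M \<otimes> N \<rightarrow> N \<otimes> M\<close>\<close>

definition tensor_flip ::
  "('k, 'r) ring_scheme \<Rightarrow> ('k, 'a, 'm) module_scheme \<Rightarrow> ('k, 'b, 'n) module_scheme
    \<Rightarrow> ('a \<times> 'b \<Rightarrow> 'k) set \<Rightarrow> ('b \<times> 'a \<Rightarrow> 'k) set"
  where "tensor_flip K M N = tensor_lift K (tensor K N M) (\<lambda>x y. pure_tensor K N M y x)"

text \<open>\<open>(M \<otimes> N) \<otimes> P \<rightarrow> M \<otimes> (N \<otimes> P)\<close>\<close>

definition tensor_assoc ::
  "('k, 'r) ring_scheme \<Rightarrow> ('k, 'a, 'm) module_scheme \<Rightarrow> ('k, 'b, 'n) module_scheme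
    \<Rightarrow> ('k, 'c, 'p) module_scheme
    \<Rightarrow> (('a \<times> 'b \<Rightarrow> 'k) set \<times> 'c \<Rightarrow> 'k) set \<Rightarrow> ('a \<times> ('b \<times> 'c \<Rightarrow> 'k) set \<Rightarrow> 'k) set"
  where "tensor_assoc K M N P = (let T = tensor K M (tensor K N P) in
    tensor_lift K T (\<lambda>w z. tensor_lift K T
      (\<lambda>x y. pure_tensor K M (tensor K N P) x (pure_tensor K N P y z)) w))"

text \<open>\<open>M \<otimes> (N \<otimes> P) \<rightarrow> (M \<otimes> N) \<otimes> P\<close>\<close>

definition tensor_assoc_inv ::
  "('k, 'r) ring_scheme \<Rightarrow> ('k, 'a, 'm) module_scheme \<Rightarrow> ('k, 'b, 'n) module_scheme
    \<Rightarrow> ('k, 'c, 'p) module_scheme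
    \<Rightarrow> ('a \<times> ('b \<times> 'c \<Rightarrow> 'k) set \<Rightarrow> 'k) set \<Rightarrow> (('a \<times> 'b \<Rightarrow> 'k) set \<times> 'c \<Rightarrow> 'k) set"
  where "tensor_assoc_inv K M N P = (let T = tensor K (tensor K M N) P in
    tensor_lift K T (\<lambda>x w. tensor_lift K T
      (\<lambda>y z. pure_tensor K (tensor K M N) P (pure_tensor K M N x y) z) w))"

text \<open>\<open>\<one> \<otimes> \<tau> \<otimes> \<one> : (M \<otimes> N) \<otimes> (P \<otimes> Q) \<rightarrow> (M \<otimes> P) \<otimes> (N \<otimes> Q)\<close>\<close>

definition tensor_middle_flip ::
  "('k, 'r) ring_scheme \<Rightarrow> ('k, 'a, 'm) module_scheme \<Rightarrow> ('k, 'b, 'n) module_scheme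
    \<Rightarrow> ('k, 'c, 'p) module_scheme \<Rightarrow> ('k, 'd, 'q) module_scheme
    \<Rightarrow> (('a \<times> 'b \<Rightarrow> 'k) set \<times> ('c \<times> 'd \<Rightarrow> 'k) set \<Rightarrow> 'k) set
    \<Rightarrow> (('a \<times> 'c \<Rightarrow> 'k) set \<times> ('b \<times> 'd \<Rightarrow> 'k) set \<Rightarrow> 'k) set"
  where "tensor_middle_flip K M N P Q = (let T = tensor K (tensor K M P) (tensor K N Q) in
    tensor_lift K T (\<lambda>v w. tensor_lift K T (\<lambda>x y. tensor_lift K T
      (\<lambda>z t. pure_tensor K (tensor K M P) (tensor K N Q)
        (pure_tensor K M P x z) (pure_tensor K N Q y t)) w) v))"


section \<open>Coalgebras and Hopf algebras\<close>

locale coalgebra = module K C for K (structure) and C (structure) +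
  fixes \<Delta> :: "'c \<Rightarrow> ('c \<times> 'c \<Rightarrow> 'a) set" and \<epsilon> :: "'c \<Rightarrow> 'a"
  assumes comult_linear: "\<Delta> \<in> linear_maps K C (tensor K C C)"
    and counit_linear: "\<epsilon> \<in> linear_maps K C (ring_as_module K)"
    and coassoc: "c \<in> carrier C \<Longrightarrow>
      tensor_assoc K C C C (tensor_map K (tensor K C C) C \<Delta> id (\<Delta> c))
        = tensor_map K C (tensor K C C) id \<Delta> (\<Delta> c)"
    and counit_left: "c \<in> carrier C \<Longrightarrow> tensor_lift K C (\<lambda>c\<^sub>1 c\<^sub>2. \<epsilon> c\<^sub>1 \<odot>\<^bsub>C\<^esub> c\<^sub>2) (\<Delta> c) = c"
    and counit_right: "c \<in> carrier C \<Longrightarrow> tensor_lift K C (\<lambda>c\<^sub>1 c\<^sub>2. \<epsilon> c\<^sub>2 \<odot>\<^bsub>C\<^esub> c\<^sub>1) (\<Delta> c) = c"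

locale hopf_algebra = coalgebra K H \<Delta> \<epsilon> + H?: ring H
  for K (structure) and H (structure) and \<Delta> \<epsilon> +
  fixes S :: "'c \<Rightarrow> 'c"
  assumes mult_bilinear: "bilinear_map K H H H (\<lambda>x y. x \<otimes>\<^bsub>H\<^esub> y)"
    and comult_mult: "\<lbrakk>x \<in> carrier H; y \<in> carrier H\<rbrakk> \<Longrightarrow>
      \<Delta> (x \<otimes>\<^bsub>H\<^esub> y) =
        tensor_lift K (tensor K H H) (\<lambda>x\<^sub>1 x\<^sub>2. tensor_lift K (tensor K H H)
          (\<lambda>y\<^sub>1 y\<^sub>2. pure_tensor K H H (x\<^sub>1 \<otimes>\<^bsub>H\<^esub> y\<^sub>1) (x\<^sub>2 \<otimes>\<^bsub>H\<^esub> y\<^sub>2)) (\<Delta> y)) (\<Delta> x)"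
    and comult_one: "\<Delta> \<one>\<^bsub>H\<^esub> = pure_tensor K H H \<one>\<^bsub>H\<^esub> \<one>\<^bsub>H\<^esub>"
    and counit_mult: "\<lbrakk>x \<in> carrier H; y \<in> carrier H\<rbrakk> \<Longrightarrow> \<epsilon> (x \<otimes>\<^bsub>H\<^esub> y) = \<epsilon> x \<otimes>\<^bsub>K\<^esub> \<epsilon> y"
    and counit_one: "\<epsilon> \<one>\<^bsub>H\<^esub> = \<one>\<^bsub>K\<^esub>"
    and antipode_linear: "S \<in> linear_maps K H H"
    and antipode_left: "h \<in> carrier H \<Longrightarrow>
      tensor_lift K H (\<lambda>h\<^sub>1 h\<^sub>2. S h\<^sub>1 \<otimes>\<^bsub>H\<^esub> h\<^sub>2) (\<Delta> h) = \<epsilon> h \<odot>\<^bsub>H\<^esub> \<one>\<^bsub>H\<^esub>"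
    and antipode_right: "h \<in> carrier H \<Longrightarrow>
      tensor_lift K H (\<lambda>h\<^sub>1 h\<^sub>2. h\<^sub>1 \<otimes>\<^bsub>H\<^esub> S h\<^sub>2) (\<Delta> h) = \<epsilon> h \<odot>\<^bsub>H\<^esub> \<one>\<^bsub>H\<^esub>"

definition cocommutative ::
  "('k, 'r) ring_scheme \<Rightarrow> ('k, 'c, 'm) module_scheme \<Rightarrow> ('c \<Rightarrow> ('c \<times> 'c \<Rightarrow> 'k) set) \<Rightarrow> bool"
  where "cocommutative K C \<Delta> \<longleftrightarrow> (\<forall>c\<in>carrier C. tensor_flip K C C (\<Delta> c) = \<Delta> c)"


section \<open>Categorical augmented racks\<close>

text \<open>\<open>(x\<^sub>1 \<otimes> x\<^sub>2) \<cdot> h = (x\<^sub>1 \<cdot> h\<^sup>(\<^sup>1\<^sup>)) \<otimes> (x\<^sub>2 \<cdot> h\<^sup>(\<^sup>2\<^sup>))\<close>\<close>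

definition diagonal_action ::
  "('k, 'r) ring_scheme \<Rightarrow> ('k, 'x, 'm) module_scheme \<Rightarrow> ('h \<Rightarrow> ('h \<times> 'h \<Rightarrow> 'k) set)
    \<Rightarrow> ('x \<Rightarrow> 'h \<Rightarrow> 'x) \<Rightarrow> ('x \<times> 'x \<Rightarrow> 'k) set \<Rightarrow> 'h \<Rightarrow> ('x \<times> 'x \<Rightarrow> 'k) set"
  where "diagonal_action K X \<Delta>\<^sub>H act z h =
    tensor_lift K (tensor K X X) (\<lambda>x\<^sub>1 x\<^sub>2. tensor_lift K (tensor K X X)
      (\<lambda>h\<^sub>1 h\<^sub>2. pure_tensor K X X (act x\<^sub>1 h\<^sub>1) (act x\<^sub>2 h\<^sub>2)) (\<Delta>\<^sub>H h)) z"

locale module_coalgebra =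
  H: hopf_algebra K H \<Delta>\<^sub>H \<epsilon>\<^sub>H S + X: coalgebra K X \<Delta>\<^sub>X \<epsilon>\<^sub>X
  for K (structure) and H (structure) and \<Delta>\<^sub>H \<epsilon>\<^sub>H S and X (structure) and \<Delta>\<^sub>X \<epsilon>\<^sub>X +
  fixes act :: "'e \<Rightarrow> 'c \<Rightarrow> 'e"
  assumes act_bilinear: "bilinear_map K X H X act"
    and act_one: "x \<in> carrier X \<Longrightarrow> act x \<one>\<^bsub>H\<^esub> = x"
    and act_mult: "\<lbrakk>x \<in> carrier X; g \<in> carrier H; h \<in> carrier H\<rbrakk> \<Longrightarrow>
      act x (g \<otimes>\<^bsub>H\<^esub> h) = act (act x g) h"
    and comult_act: "\<lbrakk>x \<in> carrier X; g \<in> carrier H\<rbrakk> \<Longrightarrow>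
      \<Delta>\<^sub>X (act x g) = diagonal_action K X \<Delta>\<^sub>H act (\<Delta>\<^sub>X x) g"

text \<open>
  Neither the action nor the augmentation map is required to be compatible with the counits.
\<close>

locale categorical_augmented_rack = module_coalgebra +
  fixes \<nu> :: "'e \<Rightarrow> 'c"
  assumes aug_linear: "\<nu> \<in> linear_maps K X H"
    and aug_comult: "x \<in> carrier X \<Longrightarrow> \<Delta>\<^sub>H (\<nu> x) = tensor_map K H H \<nu> \<nu> (\<Delta>\<^sub>X x)"
    and aug_act: "\<lbrakk>x \<in> carrier X; g \<in> carrier H\<rbrakk> \<Longrightarrow>
      \<nu> (act x g) = tensor_lift K H (\<lambda>g\<^sub>1 g\<^sub>2. S g\<^sub>1 \<otimes>\<^bsub>H\<^esub> \<nu> x \<otimes>\<^bsub>H\<^esub> g\<^sub>2) (\<Delta>\<^sub>H g)"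

definition tensor_comult ::
  "('k, 'r) ring_scheme \<Rightarrow> ('k, 'x, 'm) module_scheme \<Rightarrow> ('x \<Rightarrow> ('x \<times> 'x \<Rightarrow> 'k) set)
    \<Rightarrow> ('x \<times> 'x \<Rightarrow> 'k) set \<Rightarrow> (('x \<times> 'x \<Rightarrow> 'k) set \<times> ('x \<times> 'x \<Rightarrow> 'k) set \<Rightarrow> 'k) set"
  where "tensor_comult K X \<Delta>\<^sub>X =
    tensor_middle_flip K X X X X \<circ> tensor_map K (tensor K X X) (tensor K X X) \<Delta>\<^sub>X \<Delta>\<^sub>X"

text \<open>\<open>\<mu> (\<nu> \<otimes> \<nu>)\<close>\<close>

definition tensor_augmentation ::
  "('k, 'r) ring_scheme \<Rightarrow> ('k, 'h, 'm) module_scheme \<Rightarrow> ('x \<Rightarrow> 'h)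
    \<Rightarrow> ('x \<times> 'x \<Rightarrow> 'k) set \<Rightarrow> 'h"
  where "tensor_augmentation K H \<nu> = tensor_lift K H (\<lambda>g h. g \<otimes>\<^bsub>H\<^esub> h) \<circ> tensor_map K H H \<nu> \<nu>"

text \<open>\<open>R (u \<otimes> v) = v\<^sup>(\<^sup>1\<^sup>) \<otimes> (u \<cdot> \<nu> (v\<^sup>(\<^sup>2\<^sup>)))\<close>\<close>

definition rack_R_matrix ::
  "('k, 'r) ring_scheme \<Rightarrow> ('k, 'y, 'm) module_scheme \<Rightarrow> ('y \<Rightarrow> ('y \<times> 'y \<Rightarrow> 'k) set)
    \<Rightarrow> ('y \<Rightarrow> 'h \<Rightarrow> 'y) \<Rightarrow> ('y \<Rightarrow> 'h) \<Rightarrow> ('y \<times> 'y \<Rightarrow> 'k) set \<Rightarrow> ('y \<times> 'y \<Rightarrow> 'k) set"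
  where "rack_R_matrix K Y \<Delta>\<^sub>Y act \<nu> =
    tensor_lift K (tensor K Y Y) (\<lambda>u v. tensor_lift K (tensor K Y Y)
      (\<lambda>v\<^sub>1 v\<^sub>2. pure_tensor K Y Y v\<^sub>1 (act u (\<nu> v\<^sub>2))) (\<Delta>\<^sub>Y v))"

definition yang_baxter ::
  "('k, 'r) ring_scheme \<Rightarrow> ('k, 'y, 'm) module_scheme
    \<Rightarrow> (('y \<times> 'y \<Rightarrow> 'k) set \<Rightarrow> ('y \<times> 'y \<Rightarrow> 'k) set) \<Rightarrow> bool"
  where "yang_baxter K Y R \<longleftrightarrow>
    (let R1 = tensor_map K (tensor K Y Y) Y R id;
         R2 = tensor_assoc_inv K Y Y Y \<circ> tensor_map K Y (tensor K Y Y) id R \<circ> tensor_assoc K Y Y Y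
     in \<forall>w\<in>carrier (tensor K (tensor K Y Y) Y). R1 (R2 (R1 w)) = R2 (R1 (R2 w)))"

end

theory Submission
  imports Defs
begin

text \<open>
  For an augmented rack \<open>X\<close> over a cocommutative \<open>H\<close>, the rule for \<open>\<nu> (x \<cdot> g)\<close> is equivalent to the
  crossed relation \<open>h\<^sup>(\<^sup>1\<^sup>) \<nu> (x \<cdot> h\<^sup>(\<^sup>2\<^sup>)) = \<nu> x h\<close>. Evaluated on \<open>u \<otimes> v \<otimes> w\<close>, both sides of the
  Yang-Baxter equation for \<open>X\<close> become
  \<open>w\<^sup>(\<^sup>1\<^sup>) \<otimes> v\<^sup>(\<^sup>1\<^sup>) \<cdot> g\<^sup>(\<^sup>1\<^sup>) \<otimes> u \<cdot> \<nu> v\<^sup>(\<^sup>2\<^sup>) g\<^sup>(\<^sup>2\<^sup>)\<close> with \<open>g = \<nu> w\<^sup>(\<^sup>2\<^sup>)\<close>: the left side directly, the right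
  side after moving \<open>g\<^sup>(\<^sup>1\<^sup>)\<close> past \<open>g\<^sup>(\<^sup>2\<^sup>)\<close> by cocommutativity and then using the crossed relation.
  Since \<open>H\<close> is cocommutative, \<open>X \<otimes> X\<close> is again an augmented rack over \<open>H\<close>, so this applies to it.
\<close>

section \<open>Linear maps and free modules\<close>

text \<open>The crossed relation is preferred to conjugation because no antipode occurs in it and
  because it composes: carrying \<open>h\<close> past \<open>\<nu> x\<close> and then past
  \<open>\<nu> y\<close> carries it past the product \<open>\<nu> x \<nu> y\<close>, and this is the
  augmentation rule on the tensor square. On the square, cocommutativity enters through the
  comultiplication: acting on both factors hands legs 1, 2 of \<open>h\<close> to \<open>x\<close>
  and legs 3, 4 to \<open>y\<close>, so after the middle flip the first copy of the square carries
  legs 1, 3, while the diagonal action puts legs 1, 2 there. Legs 2 and 3 have to be exchanged.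

  What shapes the formal proof is Sweedler notation. A sum is a \<open>tensor_lift\<close>, a term
  for any function but well behaved only for a bilinear one, so every rearrangement costs a proof
  that the summand is multilinear. Hence each structural law is restated as a rule for sums with an
  arbitrary multilinear summand and target module, side conditions are discharged by resolution with
  a fixed set of linearity rules, and identities between linear maps are checked on pure
  tensors.\<close>

lemma linear_mapsI:
  assumes "\<And>x. x \<in> carrier M \<Longrightarrow> f x \<in> carrier N"
    and "\<And>x y. x \<in> carrier M \<Longrightarrow> y \<in> carrier M \<Longrightarrow> f (x \<oplus>\<^bsub>M\<^esub> y) = f x \<oplus>\<^bsub>N\<^esub> f y"
    and "\<And>r x. r \<in> carrier K \<Longrightarrow> x \<in> carrier M \<Longrightarrow> f (r \<odot>\<^bsub>M\<^esub> x) = r \<odot>\<^bsub>N\<^esub> f x"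
  shows "f \<in> linear_maps K M N"
  using assms by (auto simp: linear_maps_def)

lemma linear_maps_closed: "f \<in> linear_maps K M N \<Longrightarrow> x \<in> carrier M \<Longrightarrow> f x \<in> carrier N"
  by (auto simp: linear_maps_def)

lemma linear_maps_add:
  "f \<in> linear_maps K M N \<Longrightarrow> x \<in> carrier M \<Longrightarrow> y \<in> carrier M \<Longrightarrow> f (x \<oplus>\<^bsub>M\<^esub> y) = f x \<oplus>\<^bsub>N\<^esub> f y"
  by (auto simp: linear_maps_def)

lemma linear_maps_smult:
  "f \<in> linear_maps K M N \<Longrightarrow> r \<in> carrier K \<Longrightarrow> x \<in> carrier M \<Longrightarrow> f (r \<odot>\<^bsub>M\<^esub> x) = r \<odot>\<^bsub>N\<^esub> f x"
  by (auto simp: linear_maps_def)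

lemma linear_maps_comp:
  "f \<in> linear_maps K M N \<Longrightarrow> g \<in> linear_maps K N P \<Longrightarrow> (\<lambda>x. g (f x)) \<in> linear_maps K M P"
  by (rule linear_mapsI) (simp_all add: linear_maps_closed linear_maps_add linear_maps_smult)

lemma linear_maps_zero:
  assumes "module K M" "module K N" "f \<in> linear_maps K M N"
  shows "f \<zero>\<^bsub>M\<^esub> = \<zero>\<^bsub>N\<^esub>"
proof -
  interpret M: module K M by fact
  interpret N: module K N by fact
  have "f \<zero>\<^bsub>M\<^esub> \<oplus>\<^bsub>N\<^esub> f \<zero>\<^bsub>M\<^esub> = f \<zero>\<^bsub>M\<^esub>"
    using linear_maps_add[OF assms(3), of "\<zero>\<^bsub>M\<^esub>" "\<zero>\<^bsub>M\<^esub>"] by simp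
  then show ?thesis
    using linear_maps_closed[OF assms(3) M.M.zero_closed] by (metis N.M.add.l_cancel_one')
qed

lemma bilinear_mapI:
  assumes "\<And>x. x \<in> carrier M \<Longrightarrow> (\<lambda>y. B x y) \<in> linear_maps K N P"
    and "\<And>y. y \<in> carrier N \<Longrightarrow> (\<lambda>x. B x y) \<in> linear_maps K M P"
  shows "bilinear_map K M N P B"
  using assms by (simp add: bilinear_map_def)

lemma bilinear_mapD1: "bilinear_map K M N P B \<Longrightarrow> x \<in> carrier M \<Longrightarrow> (\<lambda>y. B x y) \<in> linear_maps K N P"
  by (simp add: bilinear_map_def)

lemma bilinear_mapD2: "bilinear_map K M N P B \<Longrightarrow> y \<in> carrier N \<Longrightarrow> (\<lambda>x. B x y) \<in> linear_maps K M P"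
  by (simp add: bilinear_map_def)

lemma bilinear_map_closed:
  "bilinear_map K M N P B \<Longrightarrow> x \<in> carrier M \<Longrightarrow> y \<in> carrier N \<Longrightarrow> B x y \<in> carrier P"
  by (meson bilinear_mapD1 linear_maps_closed)

section \<open>The base ring and free modules as modules\<close>

lemma module_ring_as_module:
  assumes "cring K" shows "module K (ring_as_module K)"
proof -
  interpret cring K by fact
  show ?thesis
    by (rule moduleI[OF assms abelian_groupI])
      (auto simp: ring_as_module_def a_assoc a_comm l_distr r_distr m_assoc add.m_lcomm intro: add.l_inv_ex)
qed

lemma free_module_carrier:
  "p \<in> carrier (free_module K A) \<longleftrightarrow>
    (\<forall>t. p t \<in> carrier K) \<and> finite {t. p t \<noteq> \<zero>\<^bsub>K\<^esub>} \<and> {t. p t \<noteq> \<zero>\<^bsub>K\<^esub>} \<subseteq> A"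
  by (auto simp: free_module_def)

lemma free_module_simps:
  "\<zero>\<^bsub>free_module K A\<^esub> = (\<lambda>_. \<zero>\<^bsub>K\<^esub>)"
  "p \<oplus>\<^bsub>free_module K A\<^esub> q = (\<lambda>t. p t \<oplus>\<^bsub>K\<^esub> q t)"
  "r \<odot>\<^bsub>free_module K A\<^esub> p = (\<lambda>t. r \<otimes>\<^bsub>K\<^esub> p t)"
  by (auto simp: free_module_def)

lemma module_free_module:
  assumes "cring K" shows "module K (free_module K A)"
proof -
  interpret cring K by fact
  have add: "(\<lambda>t. p t \<oplus>\<^bsub>K\<^esub> q t) \<in> carrier (free_module K A)"
    if "p \<in> carrier (free_module K A)" "q \<in> carrier (free_module K A)" for p q
  proof -
    have "{t. p t \<oplus>\<^bsub>K\<^esub> q t \<noteq> \<zero>\<^bsub>K\<^esub>} \<subseteq> {t. p t \<noteq> \<zero>\<^bsub>K\<^esub>} \<union> {t. q t \<noteq> \<zero>\<^bsub>K\<^esub>}"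
      by auto
    with that show ?thesis
      unfolding free_module_carrier by (meson a_closed finite_Un finite_subset le_sup_iff subset_trans)
  qed
  have smult: "(\<lambda>t. r \<otimes>\<^bsub>K\<^esub> p t) \<in> carrier (free_module K A)"
    if "r \<in> carrier K" "p \<in> carrier (free_module K A)" for r p
  proof -
    have "{t. r \<otimes>\<^bsub>K\<^esub> p t \<noteq> \<zero>\<^bsub>K\<^esub>} \<subseteq> {t. p t \<noteq> \<zero>\<^bsub>K\<^esub>}"
      using that by auto
    with that show ?thesis
      unfolding free_module_carrier by (meson m_closed finite_subset subset_trans)
  qed
  \<comment> \<open>The additive inverse is taken as the multiple by -1, so that its finite support
    comes from closure under scalars.\<close>
  have neg: "\<exists>q\<in>carrier (free_module K A). q \<oplus>\<^bsub>free_module K A\<^esub> p = \<zero>\<^bsub>free_module K A\<^esub>"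
    if "p \<in> carrier (free_module K A)" for p
    using that smult[of "\<ominus>\<^bsub>K\<^esub> \<one>\<^bsub>K\<^esub>" p]
    by (intro bexI[of _ "\<lambda>t. \<ominus>\<^bsub>K\<^esub> \<one>\<^bsub>K\<^esub> \<otimes>\<^bsub>K\<^esub> p t"])
      (auto simp: free_module_simps free_module_carrier l_minus l_neg)
  have app [simp]: "p t \<in> carrier K" if "p \<in> carrier (free_module K A)" for p t
    using that by (simp add: free_module_carrier)
  note [simp] = free_module_simps
  show ?thesis
  proof (rule moduleI[OF assms abelian_groupI])
    show "\<exists>q\<in>carrier (free_module K A). q \<oplus>\<^bsub>free_module K A\<^esub> p = \<zero>\<^bsub>free_module K A\<^esub>"
      if "p \<in> carrier (free_module K A)" for p
      using that by (rule neg)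
    show "\<zero>\<^bsub>free_module K A\<^esub> \<in> carrier (free_module K A)"
      by (simp add: free_module_carrier)
  qed (auto intro: add smult simp: a_assoc a_comm add.m_lcomm l_distr r_distr m_assoc)
qed

lemma free_gen_closed:
  assumes "cring K" "t \<in> A" shows "free_gen K t \<in> carrier (free_module K A)"
proof -
  interpret cring K by fact
  have "{s. free_gen K t s \<noteq> \<zero>\<^bsub>K\<^esub>} \<subseteq> {t}"
    by (auto simp: free_gen_def)
  with assms(2) show ?thesis
    unfolding free_module_carrier
    by (auto simp: free_gen_def dest: finite_subset)
qed

text \<open>The induction runs over a finite set \<open>T\<close> containing the support rather than
  over the support itself: erasing the coefficient at \<open>t\<close> then lands in the induction
  hypothesis whether or not that coefficient was zero. The generator case carries a coefficient,
  which spares a separate case for scalar multiples.\<close>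

lemma free_module_induct [consumes 2, case_names zero gen add]:
  assumes "cring K" "p \<in> carrier (free_module K A)"
    and zero: "Q (\<lambda>_. \<zero>\<^bsub>K\<^esub>)"
    and gen: "\<And>r t. r \<in> carrier K \<Longrightarrow> t \<in> A \<Longrightarrow> Q (r \<odot>\<^bsub>free_module K A\<^esub> free_gen K t)"
    and add: "\<And>p q. p \<in> carrier (free_module K A) \<Longrightarrow> q \<in> carrier (free_module K A) \<Longrightarrow>
      Q p \<Longrightarrow> Q q \<Longrightarrow> Q (p \<oplus>\<^bsub>free_module K A\<^esub> q)"
  shows "Q p"
proof -
  interpret cring K by fact
  interpret F: module K "free_module K A" by (rule module_free_module[OF assms(1)])
  have "finite T \<Longrightarrow> T \<subseteq> A \<Longrightarrow> \<forall>p\<in>carrier (free_module K A). {t. p t \<noteq> \<zero>\<^bsub>K\<^esub>} \<subseteq> T \<longrightarrow> Q p" for T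
  proof (induction T rule: finite_induct)
    case empty
    have "p = (\<lambda>_. \<zero>\<^bsub>K\<^esub>)" if "{t. p t \<noteq> \<zero>\<^bsub>K\<^esub>} \<subseteq> {}" for p
      using that by auto
    then show ?case using zero by auto
  next
    case (insert t T)
    show ?case
    proof (intro ballI impI)
      fix p assume p: "p \<in> carrier (free_module K A)" and supp: "{s. p s \<noteq> \<zero>\<^bsub>K\<^esub>} \<subseteq> insert t T"
      let ?q = "p(t := \<zero>\<^bsub>K\<^esub>)"
      have sub: "{s. ?q s \<noteq> \<zero>\<^bsub>K\<^esub>} \<subseteq> {s. p s \<noteq> \<zero>\<^bsub>K\<^esub>}" by auto
      have "finite {s. ?q s \<noteq> \<zero>\<^bsub>K\<^esub>}"
        by (rule finite_subset[OF sub]) (use p in \<open>simp add: free_module_carrier\<close>)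
      then have q: "?q \<in> carrier (free_module K A)"
        using p sub unfolding free_module_carrier by auto
      have "{s. ?q s \<noteq> \<zero>\<^bsub>K\<^esub>} \<subseteq> T" using supp by auto
      then have "Q ?q" using insert.IH insert.prems q by simp
      moreover have "p t \<in> carrier K" "t \<in> A" using p insert.prems by (auto simp: free_module_carrier)
      ultimately have "Q (?q \<oplus>\<^bsub>free_module K A\<^esub> (p t \<odot>\<^bsub>free_module K A\<^esub> free_gen K t))"
        by (intro add[OF q] F.smult_closed gen free_gen_closed[OF assms(1)])
      moreover have "?q \<oplus>\<^bsub>free_module K A\<^esub> (p t \<odot>\<^bsub>free_module K A\<^esub> free_gen K t) = p"
        using p by (auto simp: free_module_simps free_module_carrier free_gen_def)
      ultimately show "Q p" by simp
    qed
  qed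
  from this[of "{t. p t \<noteq> \<zero>\<^bsub>K\<^esub>}"] show ?thesis
    using assms(2) by (simp add: free_module_carrier)
qed

text \<open>The linear extension of \<open>b\<close> to the free module; with
  \<open>case_prod B\<close> for \<open>b\<close> it is the sum inside \<open>tensor_lift\<close>,
  separated from the question whether it is constant on cosets.\<close>

definition free_extension ::
  "('k, 'r) ring_scheme \<Rightarrow> ('k, 'c, 'p) module_scheme \<Rightarrow> ('t \<Rightarrow> 'c) \<Rightarrow> ('t \<Rightarrow> 'k) \<Rightarrow> 'c"
  where "free_extension K P b p = (\<Oplus>\<^bsub>P\<^esub>t\<in>{t. p t \<noteq> \<zero>\<^bsub>K\<^esub>}. p t \<odot>\<^bsub>P\<^esub> b t)"

text \<open>Coefficients may cancel, so \<open>p\<close>, \<open>q\<close> and their sum have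
  different supports. Padding with zero terms lets all three be summed over one index set, which is
  how additivity is obtained.\<close>

lemma free_extension_superset:
  assumes "module K P" "b \<in> A \<rightarrow> carrier P" "p \<in> carrier (free_module K A)"
    and "finite T" "{t. p t \<noteq> \<zero>\<^bsub>K\<^esub>} \<subseteq> T" "T \<subseteq> A"
  shows "free_extension K P b p = (\<Oplus>\<^bsub>P\<^esub>t\<in>T. p t \<odot>\<^bsub>P\<^esub> b t)"
proof -
  interpret module K P by fact
  show ?thesis
    unfolding free_extension_def
    by (rule M.add.finprod_mono_neutral_cong_left)
      (use assms in \<open>auto simp: free_module_carrier Pi_iff\<close>)
qed

lemma free_extension_linear:
  assumes "module K P" "b \<in> A \<rightarrow> carrier P"
  shows "free_extension K P b \<in> linear_maps K (free_module K A) P"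
proof -
  interpret module K P by fact
  interpret F: module K "free_module K A" by (rule module_free_module[OF R.is_cring])
  let ?s = "\<lambda>p. {t. p t \<noteq> \<zero>\<^bsub>K\<^esub>}"
  note super = free_extension_superset[OF assms]
  have b: "t \<in> A \<Longrightarrow> b t \<in> carrier P" for t using assms(2) by auto
  show ?thesis
  proof (rule linear_mapsI)
    fix p assume p: "p \<in> carrier (free_module K A)"
    show "free_extension K P b p \<in> carrier P"
      unfolding free_extension_def
      by (rule M.add.finprod_closed) (use p b in \<open>auto simp: free_module_carrier\<close>)
    fix r assume r: "r \<in> carrier K"
    have rp: "r \<odot>\<^bsub>free_module K A\<^esub> p \<in> carrier (free_module K A)"
      by (rule F.smult_closed[OF r p])
    have "free_extension K P b (r \<odot>\<^bsub>free_module K A\<^esub> p)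
        = (\<Oplus>\<^bsub>P\<^esub>t\<in>?s p. (r \<odot>\<^bsub>free_module K A\<^esub> p) t \<odot>\<^bsub>P\<^esub> b t)"
      by (rule super[OF rp]) (use p r in \<open>auto simp: free_module_simps free_module_carrier\<close>)
    also have "\<dots> = (\<Oplus>\<^bsub>P\<^esub>t\<in>?s p. r \<odot>\<^bsub>P\<^esub> (p t \<odot>\<^bsub>P\<^esub> b t))"
      by (rule M.add.finprod_cong')
        (use p r b in \<open>auto simp: free_module_simps free_module_carrier smult_assoc1 subset_iff\<close>)
    also have "\<dots> = r \<odot>\<^bsub>P\<^esub> free_extension K P b p"
      unfolding free_extension_def
      by (rule finsum_smult_ldistr[symmetric])
        (use p r b in \<open>auto simp: free_module_carrier subset_iff\<close>)
    finally show "free_extension K P b (r \<odot>\<^bsub>free_module K A\<^esub> p) = r \<odot>\<^bsub>P\<^esub> free_extension K P b p" .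
  next
    fix p q assume p: "p \<in> carrier (free_module K A)" and q: "q \<in> carrier (free_module K A)"
    let ?T = "?s p \<union> ?s q"
    have pq: "p \<oplus>\<^bsub>free_module K A\<^esub> q \<in> carrier (free_module K A)"
      by (rule F.a_closed[OF p q])
    have "free_extension K P b (p \<oplus>\<^bsub>free_module K A\<^esub> q)
        = (\<Oplus>\<^bsub>P\<^esub>t\<in>?T. (p \<oplus>\<^bsub>free_module K A\<^esub> q) t \<odot>\<^bsub>P\<^esub> b t)"
      by (rule super[OF pq]) (use p q in \<open>auto simp: free_module_simps free_module_carrier\<close>)
    also have "\<dots> = (\<Oplus>\<^bsub>P\<^esub>t\<in>?T. p t \<odot>\<^bsub>P\<^esub> b t \<oplus>\<^bsub>P\<^esub> q t \<odot>\<^bsub>P\<^esub> b t)"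
      by (rule M.add.finprod_cong')
        (use p q b in \<open>auto simp: free_module_simps free_module_carrier smult_l_distr subset_iff\<close>)
    also have "\<dots> = (\<Oplus>\<^bsub>P\<^esub>t\<in>?T. p t \<odot>\<^bsub>P\<^esub> b t) \<oplus>\<^bsub>P\<^esub> (\<Oplus>\<^bsub>P\<^esub>t\<in>?T. q t \<odot>\<^bsub>P\<^esub> b t)"
      by (rule M.add.finprod_multf) (use p q b in \<open>auto simp: free_module_carrier subset_iff\<close>)
    also have "(\<Oplus>\<^bsub>P\<^esub>t\<in>?T. p t \<odot>\<^bsub>P\<^esub> b t) = free_extension K P b p"
      by (rule super[symmetric]) (use p q in \<open>auto simp: free_module_carrier\<close>)
    also have "(\<Oplus>\<^bsub>P\<^esub>t\<in>?T. q t \<odot>\<^bsub>P\<^esub> b t) = free_extension K P b q"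
      by (rule super[symmetric]) (use p q in \<open>auto simp: free_module_carrier\<close>)
    finally show "free_extension K P b (p \<oplus>\<^bsub>free_module K A\<^esub> q)
        = free_extension K P b p \<oplus>\<^bsub>P\<^esub> free_extension K P b q" .
  qed
qed

lemma free_extension_gen:
  assumes "module K P" "b \<in> A \<rightarrow> carrier P" "t \<in> A"
  shows "free_extension K P b (free_gen K t) = b t"
proof -
  interpret module K P by fact
  have b: "b t \<in> carrier P" using assms by auto
  have "free_extension K P b (free_gen K t) = (\<Oplus>\<^bsub>P\<^esub>s\<in>{t}. free_gen K t s \<odot>\<^bsub>P\<^esub> b s)"
    by (rule free_extension_superset[OF assms(1,2) free_gen_closed[OF R.is_cring]])
      (use assms in \<open>auto simp: free_gen_def\<close>)
  also have "\<dots> = b t" using b by (simp add: free_gen_def)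
  finally show ?thesis .
qed

section \<open>Tensor products\<close>

locale two_modules = M: module K M + N: module K N
  for K :: "('k, 'r) ring_scheme" and M :: "('k, 'a, 'm) module_scheme"
    and N :: "('k, 'b, 'n) module_scheme"
begin

abbreviation "F \<equiv> free_module K (carrier M \<times> carrier N)"
abbreviation "L \<equiv> tensor_kernel K M N"

sublocale F: module K F
  by (rule module_free_module[OF M.R.is_cring])

lemma gen_closed: "x \<in> carrier M \<Longrightarrow> y \<in> carrier N \<Longrightarrow> free_gen K (x, y) \<in> carrier F"
  by (rule free_gen_closed[OF M.R.is_cring]) simp

lemma relators_closed: "tensor_relators K M N \<subseteq> carrier F"
proof -
  have "p \<ominus>\<^bsub>F\<^esub> q \<in> carrier F" if "p \<in> carrier F" "q \<in> carrier F" for p q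
    using that by (rule F.M.minus_closed)
  then show ?thesis
    unfolding tensor_relators_def Let_def
    by (auto intro!: gen_closed F.M.a_closed F.smult_closed)
qed

lemma submodule_L: "submodule L K F"
proof (rule F.submoduleI)
  \<comment> \<open>The carrier is itself a submodule containing the relators, so it is one of the
    sets being intersected.\<close>
  show "L \<subseteq> carrier F"
    using F.carrier_is_submodule relators_closed unfolding tensor_kernel_def by blast
  show "\<zero>\<^bsub>F\<^esub> \<in> L"
    unfolding tensor_kernel_def
    by (auto dest!: submodule.axioms(1) dest: subgroup.one_closed)
qed (auto simp: tensor_kernel_def
    intro: F.submoduleE(3) F.submoduleE(5) F.submoduleE(4))

sublocale L: abelian_subgroup L F
  by (rule abelian_subgroupI3)
    (auto intro: additive_subgroupI submodule.axioms(1) submodule_L F.M.abelian_group_axioms)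

lemma relator_in_L: "p \<in> tensor_relators K M N \<Longrightarrow> p \<in> L"
  unfolding tensor_kernel_def by blast

abbreviation cs :: "('a \<times> 'b \<Rightarrow> 'k) \<Rightarrow> ('a \<times> 'b \<Rightarrow> 'k) set" where "cs p \<equiv> L +>\<^bsub>F\<^esub> p"

lemma tensor_carrier: "carrier (tensor K M N) = cs ` carrier F"
  by (auto simp: tensor_def Let_def A_RCOSETS_def')

lemma tensor_add: "p \<in> carrier F \<Longrightarrow> q \<in> carrier F \<Longrightarrow>
    cs p \<oplus>\<^bsub>tensor K M N\<^esub> cs q = cs (p \<oplus>\<^bsub>F\<^esub> q)"
  using L.a_rcos_sum[of p q] by (simp add: tensor_def Let_def)

lemma tensor_zero: "\<zero>\<^bsub>tensor K M N\<^esub> = cs \<zero>\<^bsub>F\<^esub>"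
  using F.M.a_coset_add_zero[OF L.a_subset] by (simp add: tensor_def Let_def)

lemma cs_eq_iff: "p \<in> carrier F \<Longrightarrow> q \<in> carrier F \<Longrightarrow> cs p = cs q \<longleftrightarrow> p \<ominus>\<^bsub>F\<^esub> q \<in> L"
  unfolding a_minus_def
  by (metis L.a_rcos_module L.a_repr_independence' L.a_repr_independenceD)

lemma mem_cs: "p \<in> carrier F \<Longrightarrow> q \<in> cs p \<longleftrightarrow> q \<in> carrier F \<and> cs q = cs p"
  by (metis L.a_elemrcos_carrier L.a_rcos_self L.a_repr_independence')

text \<open>The scalar multiple of a coset is a union over all representatives \<open>q\<close>. The
  union is a single coset because \<open>q - p\<close> lies in \<open>L\<close>, hence so does its
  multiple by \<open>r\<close>.\<close>

lemma tensor_smult: assumes "r \<in> carrier K" "p \<in> carrier F"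
  shows "r \<odot>\<^bsub>tensor K M N\<^esub> cs p = cs (r \<odot>\<^bsub>F\<^esub> p)"
proof -
  have "cs (r \<odot>\<^bsub>F\<^esub> q) = cs (r \<odot>\<^bsub>F\<^esub> p)" if "q \<in> cs p" for q
  proof -
    have q: "q \<in> carrier F" "q \<ominus>\<^bsub>F\<^esub> p \<in> L" using that assms mem_cs cs_eq_iff by auto
    then have "r \<odot>\<^bsub>F\<^esub> (q \<ominus>\<^bsub>F\<^esub> p) \<in> L"
      using submodule.smult_closed[OF submodule_L assms(1)] by blast
    also have "r \<odot>\<^bsub>F\<^esub> (q \<ominus>\<^bsub>F\<^esub> p) = r \<odot>\<^bsub>F\<^esub> q \<ominus>\<^bsub>F\<^esub> r \<odot>\<^bsub>F\<^esub> p"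
      unfolding a_minus_def using q assms
      by (simp only: F.smult_r_distr F.M.a_inv_closed F.smult_r_minus)
    finally show ?thesis using cs_eq_iff assms q F.smult_closed by blast
  qed
  moreover have "p \<in> cs p" using assms L.a_rcos_self by blast
  ultimately have "(\<Union>q\<in>cs p. cs (r \<odot>\<^bsub>F\<^esub> q)) = cs (r \<odot>\<^bsub>F\<^esub> p)" by blast
  then show ?thesis by (simp add: tensor_def Let_def)
qed


lemma module_tensor: "module K (tensor K M N)"
proof -
  have mem: "cs p \<in> carrier (tensor K M N)" if "p \<in> carrier F" for p
    using that tensor_carrier by blast
  note ops = tensor_add tensor_smult tensor_zero
  show ?thesis
  proof (rule moduleI[OF M.R.is_cring abelian_groupI])
    show "\<zero>\<^bsub>tensor K M N\<^esub> \<in> carrier (tensor K M N)"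
      unfolding tensor_zero by (intro mem F.M.zero_closed)
  next
    fix x assume "x \<in> carrier (tensor K M N)"
    then obtain p where p: "p \<in> carrier F" "x = cs p" unfolding tensor_carrier by blast
    then show "\<exists>y\<in>carrier (tensor K M N). y \<oplus>\<^bsub>tensor K M N\<^esub> x = \<zero>\<^bsub>tensor K M N\<^esub>"
      by (intro bexI[of _ "cs (\<ominus>\<^bsub>F\<^esub> p)"])
        (simp_all add: ops mem F.M.l_neg F.M.a_inv_closed)
    show "\<zero>\<^bsub>tensor K M N\<^esub> \<oplus>\<^bsub>tensor K M N\<^esub> x = x" using p by (simp add: ops)
    show "\<one>\<^bsub>K\<^esub> \<odot>\<^bsub>tensor K M N\<^esub> x = x" using p by (simp add: ops)
    fix r assume r: "r \<in> carrier K"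
    then show "r \<odot>\<^bsub>tensor K M N\<^esub> x \<in> carrier (tensor K M N)" using p by (simp add: ops mem)
    fix s assume "s \<in> carrier K"
    then show "(r \<oplus>\<^bsub>K\<^esub> s) \<odot>\<^bsub>tensor K M N\<^esub> x
        = r \<odot>\<^bsub>tensor K M N\<^esub> x \<oplus>\<^bsub>tensor K M N\<^esub> s \<odot>\<^bsub>tensor K M N\<^esub> x"
      and "(r \<otimes>\<^bsub>K\<^esub> s) \<odot>\<^bsub>tensor K M N\<^esub> x = r \<odot>\<^bsub>tensor K M N\<^esub> (s \<odot>\<^bsub>tensor K M N\<^esub> x)"
      using p r by (simp_all add: ops F.smult_l_distr F.smult_assoc1)
  next
    fix x y assume "x \<in> carrier (tensor K M N)" "y \<in> carrier (tensor K M N)"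
    then obtain p q where p: "p \<in> carrier F" "x = cs p" "q \<in> carrier F" "y = cs q"
      unfolding tensor_carrier by blast
    then show "x \<oplus>\<^bsub>tensor K M N\<^esub> y \<in> carrier (tensor K M N)"
      and "x \<oplus>\<^bsub>tensor K M N\<^esub> y = y \<oplus>\<^bsub>tensor K M N\<^esub> x"
      by (simp_all add: ops mem F.M.a_comm)
    show "r \<odot>\<^bsub>tensor K M N\<^esub> (x \<oplus>\<^bsub>tensor K M N\<^esub> y)
        = r \<odot>\<^bsub>tensor K M N\<^esub> x \<oplus>\<^bsub>tensor K M N\<^esub> r \<odot>\<^bsub>tensor K M N\<^esub> y" if "r \<in> carrier K" for r
      using p that by (simp add: ops F.smult_r_distr)
    fix z assume "z \<in> carrier (tensor K M N)"
    then obtain s where "s \<in> carrier F" "z = cs s" unfolding tensor_carrier by blast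
    then show "(x \<oplus>\<^bsub>tensor K M N\<^esub> y) \<oplus>\<^bsub>tensor K M N\<^esub> z = x \<oplus>\<^bsub>tensor K M N\<^esub> (y \<oplus>\<^bsub>tensor K M N\<^esub> z)"
      using p by (simp add: ops F.M.a_assoc)
  qed
qed

lemma pure_tensor_closed:
  "x \<in> carrier M \<Longrightarrow> y \<in> carrier N \<Longrightarrow> pure_tensor K M N x y \<in> carrier (tensor K M N)"
  unfolding pure_tensor_def tensor_carrier using gen_closed by blast

text \<open>Each of the four clauses says that one of the four families of relators lies in
  \<open>L\<close>.\<close>

lemma bilinear_pure_tensor: "bilinear_map K M N (tensor K M N) (pure_tensor K M N)"
proof (intro bilinear_mapI linear_mapsI)
  fix x y assume x: "x \<in> carrier M" and y: "y \<in> carrier N"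
  show "pure_tensor K M N x y \<in> carrier (tensor K M N)"
    and "pure_tensor K M N x y \<in> carrier (tensor K M N)"
    using pure_tensor_closed x y by blast+
  show "pure_tensor K M N (x \<oplus>\<^bsub>M\<^esub> x') y
      = pure_tensor K M N x y \<oplus>\<^bsub>tensor K M N\<^esub> pure_tensor K M N x' y" if "x' \<in> carrier M" for x'
  proof -
    have "free_gen K (x \<oplus>\<^bsub>M\<^esub> x', y) \<ominus>\<^bsub>F\<^esub> (free_gen K (x, y) \<oplus>\<^bsub>F\<^esub> free_gen K (x', y)) \<in> L"
      by (rule relator_in_L) (use x y that in \<open>unfold tensor_relators_def Let_def, blast\<close>)
    then show ?thesis unfolding pure_tensor_def using x y that
      by (simp only: tensor_add gen_closed)
        (intro cs_eq_iff[THEN iffD2] gen_closed F.M.a_closed M.M.a_closed N.M.a_closed)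
  qed
  show "pure_tensor K M N x (y \<oplus>\<^bsub>N\<^esub> y')
      = pure_tensor K M N x y \<oplus>\<^bsub>tensor K M N\<^esub> pure_tensor K M N x y'" if "y' \<in> carrier N" for y'
  proof -
    have "free_gen K (x, y \<oplus>\<^bsub>N\<^esub> y') \<ominus>\<^bsub>F\<^esub> (free_gen K (x, y) \<oplus>\<^bsub>F\<^esub> free_gen K (x, y')) \<in> L"
      by (rule relator_in_L) (use x y that in \<open>unfold tensor_relators_def Let_def, blast\<close>)
    then show ?thesis unfolding pure_tensor_def using x y that
      by (simp only: tensor_add gen_closed)
        (intro cs_eq_iff[THEN iffD2] gen_closed F.M.a_closed M.M.a_closed N.M.a_closed)
  qed
  fix r assume r: "r \<in> carrier K"
  have "free_gen K (r \<odot>\<^bsub>M\<^esub> x, y) \<ominus>\<^bsub>F\<^esub> (r \<odot>\<^bsub>F\<^esub> free_gen K (x, y)) \<in> L"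
    by (rule relator_in_L) (use x y r in \<open>unfold tensor_relators_def Let_def, blast\<close>)
  then show "pure_tensor K M N (r \<odot>\<^bsub>M\<^esub> x) y = r \<odot>\<^bsub>tensor K M N\<^esub> pure_tensor K M N x y"
    unfolding pure_tensor_def using x y r
    by (simp only: tensor_smult gen_closed)
      (intro cs_eq_iff[THEN iffD2] gen_closed F.smult_closed M.smult_closed N.smult_closed)
  have "free_gen K (x, r \<odot>\<^bsub>N\<^esub> y) \<ominus>\<^bsub>F\<^esub> (r \<odot>\<^bsub>F\<^esub> free_gen K (x, y)) \<in> L"
    by (rule relator_in_L) (use x y r in \<open>unfold tensor_relators_def Let_def, blast\<close>)
  then show "pure_tensor K M N x (r \<odot>\<^bsub>N\<^esub> y) = r \<odot>\<^bsub>tensor K M N\<^esub> pure_tensor K M N x y"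
    unfolding pure_tensor_def using x y r
    by (simp only: tensor_smult gen_closed)
      (intro cs_eq_iff[THEN iffD2] gen_closed F.smult_closed M.smult_closed N.smult_closed)
qed

text \<open>Zero and scalar multiples need no case of their own: a scalar is absorbed into the left
  factor of a pure tensor, and zero is the pure tensor of two zeros.\<close>

lemma tensor_induct [consumes 1, case_names pure add]:
  assumes "z \<in> carrier (tensor K M N)"
    and pure: "\<And>x y. x \<in> carrier M \<Longrightarrow> y \<in> carrier N \<Longrightarrow> Q (pure_tensor K M N x y)"
    and add: "\<And>z w. z \<in> carrier (tensor K M N) \<Longrightarrow> w \<in> carrier (tensor K M N) \<Longrightarrow>
      Q z \<Longrightarrow> Q w \<Longrightarrow> Q (z \<oplus>\<^bsub>tensor K M N\<^esub> w)"
  shows "Q z"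
proof -
  interpret T: module K "tensor K M N" by (rule module_tensor)
  have smult: "r \<odot>\<^bsub>tensor K M N\<^esub> pure_tensor K M N x y = pure_tensor K M N (r \<odot>\<^bsub>M\<^esub> x) y"
    if "r \<in> carrier K" "x \<in> carrier M" "y \<in> carrier N" for r x y
    using linear_maps_smult[OF bilinear_mapD2[OF bilinear_pure_tensor]] that by metis
  have zero: "Q \<zero>\<^bsub>tensor K M N\<^esub>"
    using pure[of "\<zero>\<^bsub>M\<^esub>" "\<zero>\<^bsub>N\<^esub>"]
      linear_maps_zero[OF M.module_axioms module_tensor bilinear_mapD2[OF bilinear_pure_tensor], of "\<zero>\<^bsub>N\<^esub>"]
    by simp
  obtain p where p: "p \<in> carrier F" "z = cs p" using assms(1) unfolding tensor_carrier by blast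
  from M.R.is_cring p(1) have "Q (cs p)"
  proof (induction rule: free_module_induct)
    case zero
    then show ?case using \<open>Q \<zero>\<^bsub>tensor K M N\<^esub>\<close> by (simp add: tensor_zero free_module_simps)
  next
    case (gen r t)
    then obtain x y where "t = (x, y)" "x \<in> carrier M" "y \<in> carrier N" by auto
    then show ?case
      using gen pure[of "r \<odot>\<^bsub>M\<^esub> x" y] smult[of r x y] tensor_smult[of r "free_gen K t"] gen_closed
      by (simp add: pure_tensor_def)
  next
    case (add p q)
    then show ?case using assms(3)[of "cs p" "cs q"] tensor_add[of p q] tensor_carrier by auto
  qed
  then show ?thesis using p by simp
qed

text \<open>Bilinearity of \<open>B\<close> says that the linear extension kills every relator. Its
  kernel is thus a submodule that competes in the intersection defining \<open>L\<close>, so it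
  contains \<open>L\<close>. The extension is then constant on each coset, its image there is a
  singleton, and \<open>the_elem\<close> picks the common value.\<close>

lemma tensor_lift_coset:
  assumes "module K P" "bilinear_map K M N P B" "p \<in> carrier F"
  shows "tensor_lift K P B (cs p) = free_extension K P (case_prod B) p"
proof -
  interpret P: module K P by fact
  let ?\<phi> = "free_extension K P (case_prod B)"
  have B: "case_prod B \<in> carrier M \<times> carrier N \<rightarrow> carrier P"
    using bilinear_map_closed[OF assms(2)] by auto
  note lin = free_extension_linear[OF assms(1) B]
  note gen = free_extension_gen[OF assms(1) B, of "(_, _)", simplified]
  have minus: "?\<phi> (p \<ominus>\<^bsub>F\<^esub> q) = ?\<phi> p \<ominus>\<^bsub>P\<^esub> ?\<phi> q" if "p \<in> carrier F" "q \<in> carrier F" for p q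
  proof -
    have "?\<phi> (p \<ominus>\<^bsub>F\<^esub> q) \<oplus>\<^bsub>P\<^esub> ?\<phi> q = ?\<phi> ((p \<ominus>\<^bsub>F\<^esub> q) \<oplus>\<^bsub>F\<^esub> q)"
      using that by (intro linear_maps_add[OF lin, symmetric] F.M.minus_closed)
    also have "(p \<ominus>\<^bsub>F\<^esub> q) \<oplus>\<^bsub>F\<^esub> q = p"
      using that by (simp add: a_minus_def F.M.a_assoc F.M.l_neg)
    finally have "?\<phi> (p \<ominus>\<^bsub>F\<^esub> q) \<oplus>\<^bsub>P\<^esub> ?\<phi> q = ?\<phi> p" .
    then show ?thesis
      using linear_maps_closed[OF lin] that F.M.minus_closed
      by (metis P.M.add.inv_solve_right a_minus_def)
  qed
  \<comment> \<open>The kernel of the linear extension; only its being a submodule that contains the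
    relators matters.\<close>
  let ?S = "{p \<in> carrier F. ?\<phi> p = \<zero>\<^bsub>P\<^esub>}"
  have "submodule ?S K F"
  proof (rule F.submoduleI)
    show "\<zero>\<^bsub>F\<^esub> \<in> ?S"
      using linear_maps_zero[OF F.module_axioms assms(1) lin] by simp
    show "\<ominus>\<^bsub>F\<^esub> a \<in> ?S" if "a \<in> ?S" for a
      using that minus[of "\<zero>\<^bsub>F\<^esub>" a] linear_maps_zero[OF F.module_axioms assms(1) lin]
      by (simp add: a_minus_def)
  qed (auto simp: linear_maps_add[OF lin] linear_maps_smult[OF lin] F.M.a_closed F.smult_closed)
  moreover have "tensor_relators K M N \<subseteq> ?S"
  proof
    have S: "p \<ominus>\<^bsub>F\<^esub> q \<in> ?S" if "p \<in> carrier F" "q \<in> carrier F" "?\<phi> p = ?\<phi> q" for p q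
      using that minus[of p q] linear_maps_closed[OF lin, of q] F.M.minus_closed
      by (simp add: P.M.r_neg a_minus_def)
    note B1 = bilinear_mapD1[OF assms(2)] and B2 = bilinear_mapD2[OF assms(2)]
    fix p assume "p \<in> tensor_relators K M N"
    then show "p \<in> ?S"
      unfolding tensor_relators_def Let_def
    proof (elim UnE CollectE exE conjE, goal_cases)
      case (1 x x' y)
      show ?case
        unfolding 1(1) by (intro S gen_closed F.M.a_closed M.M.a_closed)
          (use 1(2-) in \<open>simp_all add: linear_maps_add[OF lin] gen gen_closed linear_maps_add[OF B2]\<close>)
    next
      case (2 x y y')
      show ?case
        unfolding 2(1) by (intro S gen_closed F.M.a_closed N.M.a_closed)
          (use 2(2-) in \<open>simp_all add: linear_maps_add[OF lin] gen gen_closed linear_maps_add[OF B1]\<close>)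
    next
      case (3 r x y)
      show ?case
        unfolding 3(1) by (intro S gen_closed F.smult_closed M.smult_closed)
          (use 3(2-) in \<open>simp_all add: linear_maps_smult[OF lin] gen gen_closed linear_maps_smult[OF B2]\<close>)
    next
      case (4 r x y)
      show ?case
        unfolding 4(1) by (intro S gen_closed F.smult_closed N.smult_closed)
          (use 4(2-) in \<open>simp_all add: linear_maps_smult[OF lin] gen gen_closed linear_maps_smult[OF B1]\<close>)
    qed
  qed
  ultimately have L: "L \<subseteq> ?S"
    unfolding tensor_kernel_def by blast
  have "?\<phi> q = ?\<phi> p" if "q \<in> cs p" for q
  proof -
    have q: "q \<in> carrier F" "q \<ominus>\<^bsub>F\<^esub> p \<in> L" using that assms(3) mem_cs cs_eq_iff by auto
    have "?\<phi> q = ?\<phi> ((q \<ominus>\<^bsub>F\<^esub> p) \<oplus>\<^bsub>F\<^esub> p)"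
      using q(1) assms(3) by (simp add: a_minus_def F.M.a_assoc F.M.l_neg)
    also have "\<dots> = ?\<phi> p"
      using q L assms(3) linear_maps_closed[OF lin] by (auto simp: linear_maps_add[OF lin])
    finally show ?thesis .
  qed
  moreover have "p \<in> cs p" using assms(3) L.a_rcos_self by blast
  ultimately have "?\<phi> ` cs p = {?\<phi> p}" by blast
  then show ?thesis by (simp add: tensor_lift_def free_extension_def)
qed

end

text \<open>The facts of the locale are restated with explicit module premises, so that resolution
  can apply them to iterated tensor products, where the factors change from one subgoal to the
  next.\<close>

lemma module_tensor: "module K M \<Longrightarrow> module K N \<Longrightarrow> module K (tensor K M N)"
  by (rule two_modules.module_tensor[OF two_modules.intro])

lemma pure_tensor_closed:
  "\<lbrakk>module K M; module K N; x \<in> carrier M; y \<in> carrier N\<rbrakk> \<Longrightarrow>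
    pure_tensor K M N x y \<in> carrier (tensor K M N)"
  by (rule two_modules.pure_tensor_closed[OF two_modules.intro])

lemma bilinear_pure_tensor:
  "module K M \<Longrightarrow> module K N \<Longrightarrow> bilinear_map K M N (tensor K M N) (pure_tensor K M N)"
  by (rule two_modules.bilinear_pure_tensor[OF two_modules.intro])

lemma tensor_lift_pure:
  assumes "module K M" "module K N" "module K P" "bilinear_map K M N P B"
    and "x \<in> carrier M" "y \<in> carrier N"
  shows "tensor_lift K P B (pure_tensor K M N x y) = B x y"
proof -
  interpret two_modules K M N by (intro two_modules.intro assms)
  have "case_prod B \<in> carrier M \<times> carrier N \<rightarrow> carrier P"
    using bilinear_map_closed[OF assms(4)] by auto
  from free_extension_gen[OF assms(3) this, of "(x, y)"] show ?thesis
    using assms by (simp add: pure_tensor_def tensor_lift_coset gen_closed)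
qed

lemma tensor_lift_linear:
  assumes "module K M" "module K N" "module K P" "bilinear_map K M N P B"
  shows "tensor_lift K P B \<in> linear_maps K (tensor K M N) P"
proof -
  interpret two_modules K M N by (intro two_modules.intro assms)
  have "case_prod B \<in> carrier M \<times> carrier N \<rightarrow> carrier P"
    using bilinear_map_closed[OF assms(4)] by auto
  note lin = free_extension_linear[OF assms(3) this]
  note coset = tensor_lift_coset[OF assms(3,4)]
  show ?thesis
  proof (rule linear_mapsI)
    fix z assume "z \<in> carrier (tensor K M N)"
    then obtain p where p: "p \<in> carrier F" "z = cs p" unfolding tensor_carrier by blast
    then show "tensor_lift K P B z \<in> carrier P" by (simp add: coset linear_maps_closed[OF lin])
    show "tensor_lift K P B (r \<odot>\<^bsub>tensor K M N\<^esub> z) = r \<odot>\<^bsub>P\<^esub> tensor_lift K P B z" if "r \<in> carrier K" for r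
      using p that by (simp add: tensor_smult coset linear_maps_smult[OF lin])
    fix w assume "w \<in> carrier (tensor K M N)"
    then obtain q where "q \<in> carrier F" "w = cs q" unfolding tensor_carrier by blast
    then show "tensor_lift K P B (z \<oplus>\<^bsub>tensor K M N\<^esub> w) = tensor_lift K P B z \<oplus>\<^bsub>P\<^esub> tensor_lift K P B w"
      using p by (simp add: tensor_add coset linear_maps_add[OF lin])
  qed
qed

lemma tensor_lift_closed:
  "\<lbrakk>z \<in> carrier (tensor K M N); bilinear_map K M N P B; module K M; module K N; module K P\<rbrakk> \<Longrightarrow>
    tensor_lift K P B z \<in> carrier P"
  by (rule linear_maps_closed[OF tensor_lift_linear])

lemma tensor_ext:
  assumes "module K M" "module K N"
    and f: "f \<in> linear_maps K (tensor K M N) P" and g: "g \<in> linear_maps K (tensor K M N) P"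
    and "\<And>x y. x \<in> carrier M \<Longrightarrow> y \<in> carrier N \<Longrightarrow> f (pure_tensor K M N x y) = g (pure_tensor K M N x y)"
    and "z \<in> carrier (tensor K M N)"
  shows "f z = g z"
proof -
  interpret two_modules K M N by (intro two_modules.intro assms)
  from assms(6) show ?thesis
    by (induction rule: tensor_induct) (simp_all add: assms(5) linear_maps_add[OF f] linear_maps_add[OF g])
qed

text \<open>The fold behind \<open>finsum\<close> evaluates the summand only at elements of
  \<open>A\<close>, so a derivation in its graph for \<open>f\<close> is copied insertion by
  insertion to one for \<open>g\<close>. Closure of the values is kept out of the premises, as the
  congruence rule for \<open>tensor_lift\<close> demands.\<close>

lemma finsum_cong_fun:
  fixes f g :: "'a \<Rightarrow> 'b"
  assumes "\<And>x. x \<in> A \<Longrightarrow> f x = g x"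
  shows "finsum G f A = finsum G g A"
proof -
  \<comment> \<open>Stated for fresh \<open>f\<close> and \<open>g\<close>, so that it serves both
    directions of the equivalence below.\<close>
  have "(B, y) \<in> foldSetD D (add G \<circ> g) z" if "(B, y) \<in> foldSetD D (add G \<circ> f) z" "\<forall>x\<in>B. f x = g x"
    for f g :: "'a \<Rightarrow> 'b" and B y D z
    using that
  proof (induction rule: foldSetD.induct)
    case (insertI x A y)
    then show ?case using foldSetD.insertI[of x A "add G \<circ> g" y D z] by (simp add: comp_def)
  qed (rule foldSetD.emptyI)
  then have "(A, y) \<in> foldSetD D (add G \<circ> f) z \<longleftrightarrow> (A, y) \<in> foldSetD D (add G \<circ> g) z" for y D z
    using assms by metis
  then show ?thesis by (simp add: finsum_def finprod_def foldD_def)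
qed

text \<open>
  Neither \<open>P\<close> nor the values of \<open>B\<close> and \<open>B'\<close> are constrained, so this can serve as a
  congruence rule for the simplifier.
\<close>

lemma tensor_lift_cong:
  assumes "module K M" "module K N" "z \<in> carrier (tensor K M N)"
    and eq: "\<And>x y. x \<in> carrier M \<Longrightarrow> y \<in> carrier N \<Longrightarrow> B x y = B' x y"
  shows "tensor_lift K P B z = tensor_lift K P B' z"
proof -
  interpret two_modules K M N by (intro two_modules.intro assms)
  have "z \<subseteq> carrier F"
    using assms(3) mem_cs unfolding tensor_carrier by blast
  then have "(\<Oplus>\<^bsub>P\<^esub>t\<in>{t. p t \<noteq> \<zero>\<^bsub>K\<^esub>}. p t \<odot>\<^bsub>P\<^esub> case_prod B t)
      = (\<Oplus>\<^bsub>P\<^esub>t\<in>{t. p t \<noteq> \<zero>\<^bsub>K\<^esub>}. p t \<odot>\<^bsub>P\<^esub> case_prod B' t)" if "p \<in> z" for p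
    using that by (intro finsum_cong_fun) (auto simp: free_module_carrier subset_iff eq)
  then show ?thesis unfolding tensor_lift_def by (metis (no_types, lifting) image_cong)
qed

text \<open>Both sides are linear in \<open>z\<close> and agree on pure tensors. This is the rule by
  which a linear map enters or leaves a Sweedler sum.\<close>

lemma tensor_lift_hom:
  assumes "module K M" "module K N" "module K P" "module K Q"
    and f: "f \<in> linear_maps K P Q" and B: "bilinear_map K M N P B"
    and z: "z \<in> carrier (tensor K M N)"
  shows "f (tensor_lift K P B z) = tensor_lift K Q (\<lambda>x y. f (B x y)) z"
proof -
  have fB: "bilinear_map K M N Q (\<lambda>x y. f (B x y))"
    by (intro bilinear_mapI linear_maps_comp[OF _ f] bilinear_mapD1[OF B] bilinear_mapD2[OF B])
  show ?thesis
    by (rule tensor_ext[OF assms(1,2) linear_maps_comp[OF tensor_lift_linear f]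
          tensor_lift_linear _ z])
      (auto simp: assms fB tensor_lift_pure[OF assms(1-3) B] tensor_lift_pure[OF assms(1,2,4) fB])
qed

lemma linear_maps_plus:
  assumes "module K P" "f \<in> linear_maps K M P" "g \<in> linear_maps K M P"
  shows "(\<lambda>x. f x \<oplus>\<^bsub>P\<^esub> g x) \<in> linear_maps K M P"
proof -
  interpret module K P by fact
  show ?thesis
    using assms by (intro linear_mapsI)
      (simp_all add: linear_maps_closed linear_maps_add linear_maps_smult smult_r_distr M.add.m_ac)
qed

text \<open>In a nested Sweedler sum the outer variables are parameters of the inner sum, so
  multilinearity of the whole rests on this dependence. Additivity in \<open>t\<close> is an
  equality of linear maps in \<open>z\<close>, hence visible on pure tensors; homogeneity comes from
  pushing multiplication by \<open>r\<close> through the lift.\<close>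

lemma tensor_lift_param_linear:
  assumes "module K M" "module K N" "module K P" "module K Q"
    and z: "z \<in> carrier (tensor K M N)"
    and bil: "\<And>t. t \<in> carrier Q \<Longrightarrow> bilinear_map K M N P (B t)"
    and lin: "\<And>x y. x \<in> carrier M \<Longrightarrow> y \<in> carrier N \<Longrightarrow> (\<lambda>t. B t x y) \<in> linear_maps K Q P"
  shows "(\<lambda>t. tensor_lift K P (B t) z) \<in> linear_maps K Q P"
proof -
  interpret P: module K P by fact
  interpret Q: module K Q by fact
  note pure = tensor_lift_pure[OF assms(1-3)] and lift_lin = tensor_lift_linear[OF assms(1-3)]
  show ?thesis
  proof (rule linear_mapsI)
    fix t assume t: "t \<in> carrier Q"
    show "tensor_lift K P (B t) z \<in> carrier P"
      by (rule tensor_lift_closed[OF z bil[OF t] assms(1-3)])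
    fix r assume r: "r \<in> carrier K"
    \<comment> \<open>Multiplication by \<open>r\<close> respects scalars because \<open>K\<close>
      is commutative.\<close>
    have "(\<lambda>x. r \<odot>\<^bsub>P\<^esub> x) \<in> linear_maps K P P"
      using r by (intro linear_mapsI)
        (simp_all add: P.smult_r_distr P.smult_assoc1[symmetric] P.R.m_comm)
    from tensor_lift_hom[OF assms(1-3,3) this bil[OF t] z]
    show "tensor_lift K P (B (r \<odot>\<^bsub>Q\<^esub> t)) z = r \<odot>\<^bsub>P\<^esub> tensor_lift K P (B t) z"
      using r t by (auto intro!: tensor_lift_cong[OF assms(1,2) z]
          simp: linear_maps_smult[OF lin])
  next
    fix s t assume s: "s \<in> carrier Q" and t: "t \<in> carrier Q"
    have st: "s \<oplus>\<^bsub>Q\<^esub> t \<in> carrier Q" using s t by simp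
    show "tensor_lift K P (B (s \<oplus>\<^bsub>Q\<^esub> t)) z = tensor_lift K P (B s) z \<oplus>\<^bsub>P\<^esub> tensor_lift K P (B t) z"
      by (rule tensor_ext[OF assms(1,2) lift_lin[OF bil[OF st]]
            linear_maps_plus[OF assms(3) lift_lin[OF bil[OF s]] lift_lin[OF bil[OF t]]] _ z])
        (simp add: pure bil s t linear_maps_add[OF lin])
  qed
qed

text \<open>A Fubini rule for independent sums. Both sides are linear in \<open>z\<close>, and at a
  pure tensor of \<open>a\<close> and \<open>b\<close> each is the lift of \<open>T a b\<close> over
  \<open>w\<close>.\<close>

lemma tensor_lift_swap:
  assumes "module K M" "module K N" "module K M'" "module K N'" "module K P"
    and z: "z \<in> carrier (tensor K M N)" and w: "w \<in> carrier (tensor K M' N')"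
    and T1: "\<And>c d. c \<in> carrier M' \<Longrightarrow> d \<in> carrier N' \<Longrightarrow> bilinear_map K M N P (\<lambda>a b. T a b c d)"
    and T2: "\<And>a b. a \<in> carrier M \<Longrightarrow> b \<in> carrier N \<Longrightarrow> bilinear_map K M' N' P (\<lambda>c d. T a b c d)"
  shows "tensor_lift K P (\<lambda>a b. tensor_lift K P (T a b) w) z
    = tensor_lift K P (\<lambda>c d. tensor_lift K P (\<lambda>a b. T a b c d) z) w"
proof -
  note mods = assms(1-5)
  have bil: "bilinear_map K M N P (\<lambda>a b. tensor_lift K P (T a b) w)"
    by (intro bilinear_mapI tensor_lift_param_linear[OF mods(3-5) _ w] mods T2)
      (auto intro: bilinear_mapD1[OF T1] bilinear_mapD2[OF T1])
  show ?thesis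
  proof (rule tensor_ext[OF mods(1,2) tensor_lift_linear[OF mods(1,2,5) bil] _ _ z])
    have "bilinear_map K M' N' P (\<lambda>c d. tensor_lift K P (\<lambda>a b. T a b c d) z)"
      if "z \<in> carrier (tensor K M N)" for z
      by (intro bilinear_mapI tensor_lift_param_linear[OF mods(1,2,5) _ that] mods T1)
        (auto intro: bilinear_mapD1[OF T2] bilinear_mapD2[OF T2])
    then show "(\<lambda>z. tensor_lift K P (\<lambda>c d. tensor_lift K P (\<lambda>a b. T a b c d) z) w)
        \<in> linear_maps K (tensor K M N) P"
      by (intro tensor_lift_param_linear[OF mods(3-5) _ w] tensor_lift_linear module_tensor mods T1)
  next
    fix a b assume a: "a \<in> carrier M" and b: "b \<in> carrier N"
    then show "tensor_lift K P (\<lambda>a b. tensor_lift K P (T a b) w) (pure_tensor K M N a b)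
      = tensor_lift K P (\<lambda>c d. tensor_lift K P (\<lambda>a b. T a b c d) (pure_tensor K M N a b)) w"
      by (simp add: tensor_lift_pure[OF mods(1,2,5) bil])
        (auto intro!: tensor_lift_cong[OF mods(3,4) w]
          simp: tensor_lift_pure[OF mods(1,2,5) T1])
  qed
qed

section \<open>Linearity rules for multilinear terms\<close>

lemma linear_id: "(\<lambda>x. x) \<in> linear_maps K M M"
  by (simp add: linear_maps_def)

lemma bilinear_comp_left:
  "\<lbrakk>bilinear_map K M N P B; f \<in> linear_maps K Q M; y \<in> carrier N\<rbrakk> \<Longrightarrow> (\<lambda>t. B (f t) y) \<in> linear_maps K Q P"
  by (rule linear_maps_comp[OF _ bilinear_mapD2])

lemma bilinear_comp_right:
  "\<lbrakk>bilinear_map K M N P B; f \<in> linear_maps K Q N; x \<in> carrier M\<rbrakk> \<Longrightarrow> (\<lambda>t. B x (f t)) \<in> linear_maps K Q P"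
  by (rule linear_maps_comp[OF _ bilinear_mapD1])

lemma pure_tensor_linear_left:
  "\<lbrakk>f \<in> linear_maps K Q M; y \<in> carrier N; module K M; module K N\<rbrakk> \<Longrightarrow>
    (\<lambda>t. pure_tensor K M N (f t) y) \<in> linear_maps K Q (tensor K M N)"
  by (rule bilinear_comp_left[OF bilinear_pure_tensor])

lemma pure_tensor_linear_right:
  "\<lbrakk>f \<in> linear_maps K Q N; x \<in> carrier M; module K M; module K N\<rbrakk> \<Longrightarrow>
    (\<lambda>t. pure_tensor K M N x (f t)) \<in> linear_maps K Q (tensor K M N)"
  by (rule bilinear_comp_right[OF bilinear_pure_tensor])

lemma tensor_lift_linear_comp:
  "\<lbrakk>f \<in> linear_maps K Q (tensor K M N); bilinear_map K M N P B; module K M; module K N; module K P\<rbrakk> \<Longrightarrow>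
    (\<lambda>t. tensor_lift K P B (f t)) \<in> linear_maps K Q P"
  by (rule linear_maps_comp[OF _ tensor_lift_linear])

lemmas tensor_lift_linear_param = tensor_lift_param_linear[rotated 4]

text \<open>Regarding \<open>K\<close> as a module makes a factor such as
  \<open>\<epsilon> a\<close> one more linear slot, so that terms with counits fall under the same
  linearity rules as the others.\<close>

lemma bilinear_smult: "module K M \<Longrightarrow> bilinear_map K (ring_as_module K) M M (\<lambda>r x. r \<odot>\<^bsub>M\<^esub> x)"
proof -
  assume "module K M"
  then interpret module K M .
  show ?thesis
    by (intro bilinear_mapI linear_mapsI)
      (auto simp: ring_as_module_def smult_l_distr smult_r_distr smult_assoc1 R.m_comm
        simp flip: smult_assoc1)
qed

lemma smult_linear_left:
  "\<lbrakk>f \<in> linear_maps K Q (ring_as_module K); y \<in> carrier M; module K M\<rbrakk> \<Longrightarrow>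
    (\<lambda>t. f t \<odot>\<^bsub>M\<^esub> y) \<in> linear_maps K Q M"
  by (rule bilinear_comp_left[OF bilinear_smult])

lemma smult_linear_right:
  "\<lbrakk>f \<in> linear_maps K Q M; r \<in> carrier (ring_as_module K); module K M\<rbrakk> \<Longrightarrow>
    (\<lambda>t. r \<odot>\<^bsub>M\<^esub> f t) \<in> linear_maps K Q M"
  by (rule bilinear_comp_right[OF bilinear_smult])

lemma smult_ring_as_module_closed:
  "\<lbrakk>r \<in> carrier (ring_as_module K); y \<in> carrier M; module K M\<rbrakk> \<Longrightarrow> r \<odot>\<^bsub>M\<^esub> y \<in> carrier M"
  by (rule bilinear_map_closed[OF bilinear_smult])

text \<open>
  The premises of these rules are ordered so that resolution from left to right instantiates the
  modules \<open>M\<close> and \<open>N\<close>, which \<open>tensor_lift\<close> does not mention, before they are needed. A multilinear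
  term contains each variable once, so at most one rule matches each goal.
\<close>

lemmas multilinear_intros =
  linear_id pure_tensor_linear_left pure_tensor_linear_right tensor_lift_linear_comp
  tensor_lift_linear_param smult_linear_left smult_linear_right
  smult_ring_as_module_closed tensor_lift_closed pure_tensor_closed module_tensor bilinear_mapI

lemma bilinear_pure_tensor_map:
  "\<lbrakk>module K M'; module K N'; f \<in> linear_maps K M M'; g \<in> linear_maps K N N'\<rbrakk> \<Longrightarrow>
    bilinear_map K M N (tensor K M' N') (\<lambda>x y. pure_tensor K M' N' (f x) (g y))"
  by (assumption | rule multilinear_intros linear_maps_closed[where f = f] linear_maps_closed[where f = g])+

lemma tensor_map_linear:
  "\<lbrakk>module K M; module K N; module K M'; module K N'; f \<in> linear_maps K M M'; g \<in> linear_maps K N N'\<rbrakk> \<Longrightarrow>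
    tensor_map K M' N' f g \<in> linear_maps K (tensor K M N) (tensor K M' N')"
  unfolding tensor_map_def by (intro tensor_lift_linear module_tensor bilinear_pure_tensor_map)

lemma tensor_map_pure:
  "\<lbrakk>module K M; module K N; module K M'; module K N'; f \<in> linear_maps K M M'; g \<in> linear_maps K N N';
    x \<in> carrier M; y \<in> carrier N\<rbrakk> \<Longrightarrow>
    tensor_map K M' N' f g (pure_tensor K M N x y) = pure_tensor K M' N' (f x) (g y)"
  unfolding tensor_map_def by (intro tensor_lift_pure module_tensor bilinear_pure_tensor_map)

lemma tensor_lift_map:
  assumes "module K M" "module K N" "module K M'" "module K N'" "module K P"
    and "f \<in> linear_maps K M M'" "g \<in> linear_maps K N N'" and B: "bilinear_map K M' N' P B"
    and z: "z \<in> carrier (tensor K M N)"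
  shows "tensor_lift K P B (tensor_map K M' N' f g z) = tensor_lift K P (\<lambda>x y. B (f x) (g y)) z"
  unfolding tensor_map_def using assms
  by (subst tensor_lift_hom[OF assms(1,2) module_tensor _ tensor_lift_linear bilinear_pure_tensor_map])
    (auto intro!: tensor_lift_cong[OF assms(1,2)] simp: tensor_lift_pure linear_maps_closed)

lemma tensor_lift_flip:
  assumes "module K M" "module K N" "module K P" and B: "bilinear_map K N M P B"
    and z: "z \<in> carrier (tensor K M N)"
  shows "tensor_lift K P B (tensor_flip K M N z) = tensor_lift K P (\<lambda>x y. B y x) z"
proof -
  have "bilinear_map K M N (tensor K N M) (\<lambda>x y. pure_tensor K N M y x)"
    by (assumption | rule assms multilinear_intros)+
  then show ?thesis
    unfolding tensor_flip_def using assms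
    by (subst tensor_lift_hom[OF assms(1,2) module_tensor _ tensor_lift_linear])
      (auto intro!: tensor_lift_cong[OF assms(1,2)] simp: tensor_lift_pure)
qed

section \<open>The associators and the middle flip: linearity and evaluation\<close>

lemma tensor_assoc_linear:
  assumes "module K M" "module K N" "module K P"
  shows "tensor_assoc K M N P \<in> linear_maps K (tensor K (tensor K M N) P) (tensor K M (tensor K N P))"
  unfolding tensor_assoc_def Let_def
  by (intro tensor_lift_linear module_tensor assms) (assumption | rule assms multilinear_intros)+

lemma tensor_assoc_pure:
  assumes "module K M" "module K N" "module K P" "w \<in> carrier (tensor K M N)" "z \<in> carrier P"
  shows "tensor_assoc K M N P (pure_tensor K (tensor K M N) P w z)
    = tensor_lift K (tensor K M (tensor K N P))
        (\<lambda>x y. pure_tensor K M (tensor K N P) x (pure_tensor K N P y z)) w"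
  unfolding tensor_assoc_def Let_def
  by (rule tensor_lift_pure) (assumption | rule assms multilinear_intros)+

lemma tensor_assoc_inv_linear:
  assumes "module K M" "module K N" "module K P"
  shows "tensor_assoc_inv K M N P \<in> linear_maps K (tensor K M (tensor K N P)) (tensor K (tensor K M N) P)"
  unfolding tensor_assoc_inv_def Let_def
  by (intro tensor_lift_linear module_tensor assms) (assumption | rule assms multilinear_intros)+

lemma tensor_assoc_inv_pure:
  assumes "module K M" "module K N" "module K P" "w \<in> carrier (tensor K N P)" "x \<in> carrier M"
  shows "tensor_assoc_inv K M N P (pure_tensor K M (tensor K N P) x w)
    = tensor_lift K (tensor K (tensor K M N) P)
        (\<lambda>y z. pure_tensor K (tensor K M N) P (pure_tensor K M N x y) z) w"
  unfolding tensor_assoc_inv_def Let_def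
  by (rule tensor_lift_pure) (assumption | rule assms multilinear_intros)+

lemma tensor_middle_flip_linear:
  assumes "module K M" "module K N" "module K P" "module K Q"
  shows "tensor_middle_flip K M N P Q \<in> linear_maps K (tensor K (tensor K M N) (tensor K P Q))
    (tensor K (tensor K M P) (tensor K N Q))"
  unfolding tensor_middle_flip_def Let_def
  by (intro tensor_lift_linear module_tensor assms) (assumption | rule assms multilinear_intros)+

lemma tensor_middle_flip_pure:
  assumes "module K M" "module K N" "module K P" "module K Q"
    and "v \<in> carrier (tensor K M N)" "w \<in> carrier (tensor K P Q)"
  shows "tensor_middle_flip K M N P Q (pure_tensor K (tensor K M N) (tensor K P Q) v w)
    = tensor_lift K (tensor K (tensor K M P) (tensor K N Q)) (\<lambda>x y.
        tensor_lift K (tensor K (tensor K M P) (tensor K N Q)) (\<lambda>z t.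
          pure_tensor K (tensor K M P) (tensor K N Q) (pure_tensor K M P x z) (pure_tensor K N Q y t)) w) v"
  unfolding tensor_middle_flip_def Let_def
  by (rule tensor_lift_pure) (assumption | rule assms multilinear_intros)+

section \<open>Sweedler calculus\<close>

lemma linear_maps_id: "id \<in> linear_maps K M M"
  by (simp add: linear_maps_def)

text \<open>Read from right to left, it expands an arbitrary tensor as its own Sweedler sum.\<close>

lemma tensor_lift_pure_tensor_id:
  assumes "module K M" "module K N" "z \<in> carrier (tensor K M N)"
  shows "tensor_lift K (tensor K M N) (pure_tensor K M N) z = z"
  by (rule tensor_ext[OF assms(1,2) tensor_lift_linear linear_id _ assms(3)])
    (auto simp: assms(1,2) tensor_lift_pure module_tensor bilinear_pure_tensor)

text \<open>With \<open>tensor_assoc_comult_left\<close>, this turns the two sides of the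
  coassociativity axiom into nested sums of pure threefold tensors. The inner sum arises by
  expanding \<open>D b\<close> into pure tensors and pushing the linear map that tensors with
  \<open>a\<close> through the expansion.\<close>

lemma tensor_map_comult_right:
  assumes C: "module K C" and D: "D \<in> linear_maps K C (tensor K C C)"
    and z: "z \<in> carrier (tensor K C C)"
  defines "T \<equiv> tensor K C (tensor K C C)"
  shows "tensor_map K C (tensor K C C) id D z
    = tensor_lift K T (\<lambda>a b. tensor_lift K T (\<lambda>c d. pure_tensor K C (tensor K C C) a (pure_tensor K C C c d)) (D b)) z"
proof -
  note intros = C multilinear_intros linear_maps_comp[OF _ D] linear_maps_closed[OF D]
  have "pure_tensor K C (tensor K C C) a w
      = tensor_lift K T (\<lambda>c d. pure_tensor K C (tensor K C C) a (pure_tensor K C C c d)) w"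
    if "a \<in> carrier C" "w \<in> carrier (tensor K C C)" for a w
  proof -
    have "(\<lambda>w. pure_tensor K C (tensor K C C) a w) \<in> linear_maps K (tensor K C C) T"
      unfolding T_def by (assumption | rule that intros)+
    from tensor_lift_hom[OF C C module_tensor[OF C C] _ this bilinear_pure_tensor[OF C C] that(2)]
    show ?thesis
      using that C by (simp add: T_def module_tensor tensor_lift_pure_tensor_id)
  qed
  then show ?thesis
    unfolding tensor_map_def T_def
    by (intro tensor_lift_cong[OF C C z]) (simp add: linear_maps_closed[OF D])
qed

lemma tensor_assoc_comult_left:
  assumes C: "module K C" and D: "D \<in> linear_maps K C (tensor K C C)"
    and z: "z \<in> carrier (tensor K C C)"
  defines "T \<equiv> tensor K C (tensor K C C)"
  shows "tensor_assoc K C C C (tensor_map K (tensor K C C) C D id z)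
    = tensor_lift K T (\<lambda>a b. tensor_lift K T (\<lambda>c d. pure_tensor K C (tensor K C C) c (pure_tensor K C C d b)) (D a)) z"
proof -
  note intros = C multilinear_intros linear_maps_comp[OF _ D] linear_maps_closed[OF D]
  have "tensor_assoc K C C C (tensor_map K (tensor K C C) C D id z)
      = tensor_lift K T (\<lambda>a b. tensor_assoc K C C C (pure_tensor K (tensor K C C) C (D a) (id b))) z"
    unfolding tensor_map_def T_def
    by (rule tensor_lift_hom[OF _ _ _ _ tensor_assoc_linear])
      (assumption | rule intros z C linear_maps_id D bilinear_pure_tensor_map)+
  also have "\<dots> = tensor_lift K T (\<lambda>a b. tensor_lift K T (\<lambda>c d. pure_tensor K C (tensor K C C) c (pure_tensor K C C d b)) (D a)) z"
    unfolding T_def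
    by (intro tensor_lift_cong[OF C C z]) (simp add: linear_maps_closed[OF D] tensor_assoc_pure C)
  finally show ?thesis .
qed

section \<open>Coassociativity, counit and cocommutativity as rules for Sweedler sums\<close>

context coalgebra
begin

lemma comult_closed: "c \<in> carrier C \<Longrightarrow> \<Delta> c \<in> carrier (tensor K C C)"
  by (rule linear_maps_closed[OF comult_linear])

lemmas sweedler_cong = tensor_lift_cong[OF module_axioms module_axioms comult_closed]

lemmas sweedler_hom = tensor_lift_hom[OF module_axioms module_axioms _ _ _ _ comult_closed]

lemmas coalgebra_intros =
  module_axioms linear_maps_comp[OF _ comult_linear] comult_closed
  linear_maps_comp[OF _ counit_linear] linear_maps_closed[OF counit_linear]

text \<open>A trilinear \<open>T\<close> factors through the threefold tensor product as a linear
  map \<open>\<Phi>\<close>; the rule is the coassociativity axiom with \<open>\<Phi>\<close>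
  applied to both sides.\<close>

lemma sweedler_coassoc:
  assumes P: "module K P" and c: "c \<in> carrier C"
    and T1: "\<And>x. x \<in> carrier C \<Longrightarrow> bilinear_map K C C P (\<lambda>y z. T x y z)"
    and T2: "\<And>z. z \<in> carrier C \<Longrightarrow> bilinear_map K C C P (\<lambda>x y. T x y z)"
  shows "tensor_lift K P (\<lambda>a b. tensor_lift K P (\<lambda>x y. T x y b) (\<Delta> a)) (\<Delta> c)
    = tensor_lift K P (\<lambda>a b. tensor_lift K P (\<lambda>x y. T a x y) (\<Delta> b)) (\<Delta> c)"
proof -
  let ?CC = "tensor K C C"
  let ?CCC = "tensor K C ?CC"
  let ?p = "\<lambda>x y z. pure_tensor K C ?CC x (pure_tensor K C C y z)"
  define \<Phi> where "\<Phi> = tensor_lift K P (\<lambda>x w. tensor_lift K P (\<lambda>y z. T x y z) w)"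
  have T: "(\<lambda>t. T t y z) \<in> linear_maps K C P" "(\<lambda>t. T x t z) \<in> linear_maps K C P"
      "(\<lambda>t. T x y t) \<in> linear_maps K C P" if "x \<in> carrier C" "y \<in> carrier C" "z \<in> carrier C" for x y z
    by (rule bilinear_mapD2[OF T2] bilinear_mapD1[OF T2] bilinear_mapD1[OF T1]; fact)+
  note intros = P multilinear_intros coalgebra_intros
  have bil: "bilinear_map K C ?CC P (\<lambda>x w. tensor_lift K P (\<lambda>y z. T x y z) w)"
    by (assumption | rule intros T)+
  have \<Phi>: "\<Phi> \<in> linear_maps K ?CCC P"
    unfolding \<Phi>_def by (rule tensor_lift_linear[OF _ _ _ bil]) (assumption | rule intros)+
  have \<Phi>_pure: "\<Phi> (?p x y z) = T x y z" if "x \<in> carrier C" "y \<in> carrier C" "z \<in> carrier C" for x y z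
    unfolding \<Phi>_def using that T1
    by (simp add: tensor_lift_pure[OF _ _ _ bil] module_axioms P module_tensor pure_tensor_closed tensor_lift_pure)
  \<comment> \<open>The inner tensor \<open>z a b\<close> stays general because it is
    \<open>\<Delta> a\<close> for one side of coassociativity and \<open>\<Delta> b\<close> for the
    other.\<close>
  have push: "\<Phi> (tensor_lift K ?CCC (\<lambda>a b. tensor_lift K ?CCC (B a b) (z a b)) (\<Delta> c))
      = tensor_lift K P (\<lambda>a b. tensor_lift K P (\<lambda>x y. \<Phi> (B a b x y)) (z a b)) (\<Delta> c)"
    if "bilinear_map K C C ?CCC (\<lambda>a b. tensor_lift K ?CCC (B a b) (z a b))"
      "\<And>a b. a \<in> carrier C \<Longrightarrow> b \<in> carrier C \<Longrightarrow> bilinear_map K C C ?CCC (B a b)"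
      "\<And>a b. a \<in> carrier C \<Longrightarrow> b \<in> carrier C \<Longrightarrow> z a b \<in> carrier ?CC" for B z
  proof -
    have "\<Phi> (tensor_lift K ?CCC (\<lambda>a b. tensor_lift K ?CCC (B a b) (z a b)) (\<Delta> c))
      = tensor_lift K P (\<lambda>a b. \<Phi> (tensor_lift K ?CCC (B a b) (z a b))) (\<Delta> c)"
      by (rule sweedler_hom[OF _ _ \<Phi> that(1) c]) (assumption | rule intros)+
    also have "\<dots> = tensor_lift K P (\<lambda>a b. tensor_lift K P (\<lambda>x y. \<Phi> (B a b x y)) (z a b)) (\<Delta> c)"
      by (rule sweedler_cong[OF c], rule tensor_lift_hom[OF _ _ _ _ \<Phi> that(2,3)]) (assumption | rule intros)+
    finally show ?thesis .
  qed
  have "\<Phi> (tensor_lift K ?CCC (\<lambda>a b. tensor_lift K ?CCC (\<lambda>x y. ?p x y b) (\<Delta> a)) (\<Delta> c))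
      = \<Phi> (tensor_lift K ?CCC (\<lambda>a b. tensor_lift K ?CCC (\<lambda>x y. ?p a x y) (\<Delta> b)) (\<Delta> c))"
    using coassoc[OF c] tensor_assoc_comult_left[OF module_axioms comult_linear comult_closed[OF c]]
      tensor_map_comult_right[OF module_axioms comult_linear comult_closed[OF c]] by simp
  also have "\<Phi> (tensor_lift K ?CCC (\<lambda>a b. tensor_lift K ?CCC (\<lambda>x y. ?p x y b) (\<Delta> a)) (\<Delta> c))
      = tensor_lift K P (\<lambda>a b. tensor_lift K P (\<lambda>x y. \<Phi> (?p x y b)) (\<Delta> a)) (\<Delta> c)"
    by (rule push) (assumption | rule intros)+
  also have "\<dots> = tensor_lift K P (\<lambda>a b. tensor_lift K P (\<lambda>x y. T x y b) (\<Delta> a)) (\<Delta> c)"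
    by (intro sweedler_cong c \<Phi>_pure)
  also have "\<Phi> (tensor_lift K ?CCC (\<lambda>a b. tensor_lift K ?CCC (\<lambda>x y. ?p a x y) (\<Delta> b)) (\<Delta> c))
      = tensor_lift K P (\<lambda>a b. tensor_lift K P (\<lambda>x y. \<Phi> (?p a x y)) (\<Delta> b)) (\<Delta> c)"
    by (rule push) (assumption | rule intros)+
  also have "\<dots> = tensor_lift K P (\<lambda>a b. tensor_lift K P (\<lambda>x y. T a x y) (\<Delta> b)) (\<Delta> c)"
    by (intro sweedler_cong c \<Phi>_pure)
  finally show ?thesis .
qed

text \<open>The map \<open>f\<close> stands for whatever linear context surrounds the second leg, so
  that a counit can be cancelled deep inside a larger term.\<close>

lemma sweedler_counit_left:
  assumes P: "module K P" and f: "f \<in> linear_maps K C P" and c: "c \<in> carrier C"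
  shows "tensor_lift K P (\<lambda>a b. \<epsilon> a \<odot>\<^bsub>P\<^esub> f b) (\<Delta> c) = f c"
proof -
  have "f c = f (tensor_lift K C (\<lambda>a b. \<epsilon> a \<odot>\<^bsub>C\<^esub> b) (\<Delta> c))"
    by (simp add: counit_left c)
  also have "\<dots> = tensor_lift K P (\<lambda>a b. f (\<epsilon> a \<odot>\<^bsub>C\<^esub> b)) (\<Delta> c)"
    by (rule sweedler_hom[OF _ _ f _ c]) (assumption | rule P multilinear_intros coalgebra_intros)+
  also have "\<dots> = tensor_lift K P (\<lambda>a b. \<epsilon> a \<odot>\<^bsub>P\<^esub> f b) (\<Delta> c)"
    using linear_maps_closed[OF counit_linear]
    by (intro sweedler_cong c linear_maps_smult[OF f]) (auto simp: ring_as_module_def)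
  finally show ?thesis by simp
qed

lemma sweedler_counit_right:
  assumes P: "module K P" and f: "f \<in> linear_maps K C P" and c: "c \<in> carrier C"
  shows "tensor_lift K P (\<lambda>a b. \<epsilon> b \<odot>\<^bsub>P\<^esub> f a) (\<Delta> c) = f c"
proof -
  have "f c = f (tensor_lift K C (\<lambda>a b. \<epsilon> b \<odot>\<^bsub>C\<^esub> a) (\<Delta> c))"
    by (simp add: counit_right c)
  also have "\<dots> = tensor_lift K P (\<lambda>a b. f (\<epsilon> b \<odot>\<^bsub>C\<^esub> a)) (\<Delta> c)"
    by (rule sweedler_hom[OF _ _ f _ c]) (assumption | rule P multilinear_intros coalgebra_intros)+
  also have "\<dots> = tensor_lift K P (\<lambda>a b. \<epsilon> b \<odot>\<^bsub>P\<^esub> f a) (\<Delta> c)"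
    using linear_maps_closed[OF counit_linear]
    by (intro sweedler_cong c linear_maps_smult[OF f]) (auto simp: ring_as_module_def)
  finally show ?thesis by simp
qed

lemma sweedler_cocomm:
  assumes "cocommutative K C \<Delta>" "module K P" "bilinear_map K C C P B" "c \<in> carrier C"
  shows "tensor_lift K P (\<lambda>a b. B b a) (\<Delta> c) = tensor_lift K P B (\<Delta> c)"
  using tensor_lift_flip[OF module_axioms module_axioms assms(2,3) comult_closed[OF assms(4)]] assms(1,4)
  by (simp add: cocommutative_def)

text \<open>\<open>c\<^sup>(\<^sup>1\<^sup>) \<otimes> c\<^sup>(\<^sup>2\<^sup>) \<otimes> c\<^sup>(\<^sup>3\<^sup>) = c\<^sup>(\<^sup>2\<^sup>) \<otimes> c\<^sup>(\<^sup>1\<^sup>) \<otimes> c\<^sup>(\<^sup>3\<^sup>)\<close>\<close>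

lemma sweedler_swap12:
  assumes cc: "cocommutative K C \<Delta>" and P: "module K P" and c: "c \<in> carrier C"
    and T1: "\<And>x. x \<in> carrier C \<Longrightarrow> bilinear_map K C C P (\<lambda>y z. T x y z)"
    and T2: "\<And>z. z \<in> carrier C \<Longrightarrow> bilinear_map K C C P (\<lambda>x y. T x y z)"
  shows "tensor_lift K P (\<lambda>a b. tensor_lift K P (\<lambda>x y. T x a y) (\<Delta> b)) (\<Delta> c)
    = tensor_lift K P (\<lambda>a b. tensor_lift K P (\<lambda>x y. T a x y) (\<Delta> b)) (\<Delta> c)"
proof -
  have T: "(\<lambda>t. T t y z) \<in> linear_maps K C P" "(\<lambda>t. T x t z) \<in> linear_maps K C P"
      "(\<lambda>t. T x y t) \<in> linear_maps K C P" if "x \<in> carrier C" "y \<in> carrier C" "z \<in> carrier C" for x y z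
    by (rule bilinear_mapD2[OF T2] bilinear_mapD1[OF T2] bilinear_mapD1[OF T1]; fact)+
  have "tensor_lift K P (\<lambda>a b. tensor_lift K P (\<lambda>x y. T x a y) (\<Delta> b)) (\<Delta> c)
      = tensor_lift K P (\<lambda>a b. tensor_lift K P (\<lambda>x y. T y x b) (\<Delta> a)) (\<Delta> c)"
    by (rule sweedler_coassoc[symmetric, OF P c, where T = "\<lambda>x y z. T y x z"]; intro bilinear_mapI T)
  also have "\<dots> = tensor_lift K P (\<lambda>a b. tensor_lift K P (\<lambda>x y. T x y b) (\<Delta> a)) (\<Delta> c)"
    by (intro sweedler_cong c sweedler_cocomm[OF cc P T2])
  also have "\<dots> = tensor_lift K P (\<lambda>a b. tensor_lift K P (\<lambda>x y. T a x y) (\<Delta> b)) (\<Delta> c)"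
    by (intro sweedler_coassoc P c T1 T2)
  finally show ?thesis .
qed

text \<open>\<open>c\<^sup>(\<^sup>1\<^sup>) \<otimes> c\<^sup>(\<^sup>2\<^sup>) \<otimes> c\<^sup>(\<^sup>3\<^sup>) \<otimes> c\<^sup>(\<^sup>4\<^sup>) = c\<^sup>(\<^sup>1\<^sup>) \<otimes> c\<^sup>(\<^sup>3\<^sup>) \<otimes> c\<^sup>(\<^sup>2\<^sup>) \<otimes> c\<^sup>(\<^sup>4\<^sup>)\<close>\<close>

lemma sweedler_swap23:
  assumes cc: "cocommutative K C \<Delta>" and P: "module K P" and c: "c \<in> carrier C"
    and T: "\<And>x y z. x \<in> carrier C \<Longrightarrow> y \<in> carrier C \<Longrightarrow> z \<in> carrier C \<Longrightarrow> (\<lambda>t. T t x y z) \<in> linear_maps K C P"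
      "\<And>x y z. x \<in> carrier C \<Longrightarrow> y \<in> carrier C \<Longrightarrow> z \<in> carrier C \<Longrightarrow> (\<lambda>t. T x t y z) \<in> linear_maps K C P"
      "\<And>x y z. x \<in> carrier C \<Longrightarrow> y \<in> carrier C \<Longrightarrow> z \<in> carrier C \<Longrightarrow> (\<lambda>t. T x y t z) \<in> linear_maps K C P"
      "\<And>x y z. x \<in> carrier C \<Longrightarrow> y \<in> carrier C \<Longrightarrow> z \<in> carrier C \<Longrightarrow> (\<lambda>t. T x y z t) \<in> linear_maps K C P"
  shows "tensor_lift K P (\<lambda>a b. tensor_lift K P (\<lambda>x y. tensor_lift K P (\<lambda>z w. T x z y w) (\<Delta> b)) (\<Delta> a)) (\<Delta> c)
    = tensor_lift K P (\<lambda>a b. tensor_lift K P (\<lambda>x y. tensor_lift K P (\<lambda>z w. T x y z w) (\<Delta> b)) (\<Delta> a)) (\<Delta> c)"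
proof -
  note intros = P multilinear_intros coalgebra_intros T
  have "tensor_lift K P (\<lambda>a b. tensor_lift K P (\<lambda>x y. tensor_lift K P (\<lambda>z w. T x z y w) (\<Delta> b)) (\<Delta> a)) (\<Delta> c)
      = tensor_lift K P (\<lambda>a b. tensor_lift K P (\<lambda>x y. tensor_lift K P (\<lambda>z w. T a z x w) (\<Delta> y)) (\<Delta> b)) (\<Delta> c)"
    by (rule sweedler_coassoc[OF P c, where T = "\<lambda>x y v. tensor_lift K P (\<lambda>z w. T x z y w) (\<Delta> v)"])
      (assumption | rule intros)+
  also have "\<dots> = tensor_lift K P (\<lambda>a b. tensor_lift K P (\<lambda>x y. tensor_lift K P (\<lambda>z w. T a x z w) (\<Delta> y)) (\<Delta> b)) (\<Delta> c)"
    by (intro sweedler_cong c sweedler_swap12[OF cc P, where T = "T a" for a])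
      (assumption | rule intros)+
  also have "\<dots> = tensor_lift K P (\<lambda>a b. tensor_lift K P (\<lambda>x y. tensor_lift K P (\<lambda>z w. T x y z w) (\<Delta> b)) (\<Delta> a)) (\<Delta> c)"
    by (rule sweedler_coassoc[symmetric, OF P c, where T = "\<lambda>x y v. tensor_lift K P (\<lambda>z w. T x y z w) (\<Delta> v)"])
      (assumption | rule intros)+
  finally show ?thesis .
qed

end

section \<open>Antipode cancellation; passing between conjugation and the crossed relation\<close>

context hopf_algebra
begin

lemmas hopf_intros =
  coalgebra_intros mult_bilinear bilinear_comp_left[OF mult_bilinear] bilinear_comp_right[OF mult_bilinear]
  linear_maps_comp[OF _ antipode_linear] linear_maps_closed[OF antipode_linear]
  H.m_closed H.one_closed

lemma sweedler_mult:
  assumes P: "module K P" and B: "bilinear_map K H H P B" and x: "x \<in> carrier H" and y: "y \<in> carrier H"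
  shows "tensor_lift K P B (\<Delta> (x \<otimes>\<^bsub>H\<^esub> y))
    = tensor_lift K P (\<lambda>x\<^sub>1 x\<^sub>2. tensor_lift K P (\<lambda>y\<^sub>1 y\<^sub>2. B (x\<^sub>1 \<otimes>\<^bsub>H\<^esub> y\<^sub>1) (x\<^sub>2 \<otimes>\<^bsub>H\<^esub> y\<^sub>2)) (\<Delta> y)) (\<Delta> x)"
proof -
  note intros = P multilinear_intros hopf_intros x y
  note lin = tensor_lift_linear[OF module_axioms module_axioms P B]
  show ?thesis
    unfolding comult_mult[OF x y]
    apply (subst sweedler_hom[OF _ _ lin _ x], (assumption | rule intros)+)
    apply (rule sweedler_cong[OF x])
    apply (subst sweedler_hom[OF _ _ lin _ y], (assumption | rule intros)+)
    apply (rule sweedler_cong[OF y])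
    apply (rule tensor_lift_pure[OF _ _ P B], (assumption | rule intros)+)
    done
qed

lemma sweedler_antipode_left:
  assumes P: "module K P" and f: "f \<in> linear_maps K H P" and h: "h \<in> carrier H"
  shows "tensor_lift K P (\<lambda>a b. f (S a \<otimes>\<^bsub>H\<^esub> b)) (\<Delta> h) = \<epsilon> h \<odot>\<^bsub>P\<^esub> f \<one>\<^bsub>H\<^esub>"
proof -
  have "tensor_lift K P (\<lambda>a b. f (S a \<otimes>\<^bsub>H\<^esub> b)) (\<Delta> h) = f (tensor_lift K H (\<lambda>a b. S a \<otimes>\<^bsub>H\<^esub> b) (\<Delta> h))"
    by (rule sweedler_hom[symmetric, OF _ _ f _ h]) (assumption | rule P multilinear_intros hopf_intros)+
  also have "\<dots> = \<epsilon> h \<odot>\<^bsub>P\<^esub> f \<one>\<^bsub>H\<^esub>"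
    using linear_maps_closed[OF counit_linear h]
    by (simp add: antipode_left[OF h] linear_maps_smult[OF f] ring_as_module_def)
  finally show ?thesis .
qed

lemma sweedler_antipode_right:
  assumes P: "module K P" and f: "f \<in> linear_maps K H P" and h: "h \<in> carrier H"
  shows "tensor_lift K P (\<lambda>a b. f (a \<otimes>\<^bsub>H\<^esub> S b)) (\<Delta> h) = \<epsilon> h \<odot>\<^bsub>P\<^esub> f \<one>\<^bsub>H\<^esub>"
proof -
  have "tensor_lift K P (\<lambda>a b. f (a \<otimes>\<^bsub>H\<^esub> S b)) (\<Delta> h) = f (tensor_lift K H (\<lambda>a b. a \<otimes>\<^bsub>H\<^esub> S b) (\<Delta> h))"
    by (rule sweedler_hom[symmetric, OF _ _ f _ h]) (assumption | rule P multilinear_intros hopf_intros)+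
  also have "\<dots> = \<epsilon> h \<odot>\<^bsub>P\<^esub> f \<one>\<^bsub>H\<^esub>"
    using linear_maps_closed[OF counit_linear h]
    by (simp add: antipode_right[OF h] linear_maps_smult[OF f] ring_as_module_def)
  finally show ?thesis .
qed

text \<open>In Sweedler form, \<open>h1 f(h2) = h1 S(h2) y h3 = y h\<close>: coassociativity brings
  \<open>h1\<close> and \<open>S(h2)\<close> together, where they collapse to a counit. For a rack,
  \<open>f h\<close> is \<open>\<nu> (act x h)\<close> and \<open>y\<close> is
  \<open>\<nu> x\<close>.\<close>

lemma crossed_of_conjugation:
  assumes f: "\<And>h. h \<in> carrier H \<Longrightarrow> f h = tensor_lift K H (\<lambda>a b. S a \<otimes>\<^bsub>H\<^esub> y \<otimes>\<^bsub>H\<^esub> b) (\<Delta> h)"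
    and y: "y \<in> carrier H" and h: "h \<in> carrier H"
  shows "tensor_lift K H (\<lambda>a b. a \<otimes>\<^bsub>H\<^esub> f b) (\<Delta> h) = y \<otimes>\<^bsub>H\<^esub> h"
proof -
  note intros = multilinear_intros hopf_intros y
  have "tensor_lift K H (\<lambda>a b. a \<otimes>\<^bsub>H\<^esub> f b) (\<Delta> h)
      = tensor_lift K H (\<lambda>a b. tensor_lift K H (\<lambda>c d. a \<otimes>\<^bsub>H\<^esub> (S c \<otimes>\<^bsub>H\<^esub> y \<otimes>\<^bsub>H\<^esub> d)) (\<Delta> b)) (\<Delta> h)"
    by (rule sweedler_cong[OF h], simp only: f, rule sweedler_hom[OF _ _ bilinear_mapD1[OF mult_bilinear]])
      (assumption | rule intros)+
  also have "\<dots> = tensor_lift K H (\<lambda>a b. tensor_lift K H (\<lambda>c d. c \<otimes>\<^bsub>H\<^esub> (S d \<otimes>\<^bsub>H\<^esub> y \<otimes>\<^bsub>H\<^esub> b)) (\<Delta> a)) (\<Delta> h)"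
    by (rule sweedler_coassoc[OF _ h, symmetric, where T = "\<lambda>a c d. a \<otimes>\<^bsub>H\<^esub> (S c \<otimes>\<^bsub>H\<^esub> y \<otimes>\<^bsub>H\<^esub> d)"])
      (assumption | rule intros)+
  also have "\<dots> = tensor_lift K H (\<lambda>a b. tensor_lift K H (\<lambda>c d. c \<otimes>\<^bsub>H\<^esub> S d \<otimes>\<^bsub>H\<^esub> (y \<otimes>\<^bsub>H\<^esub> b)) (\<Delta> a)) (\<Delta> h)"
    by (intro sweedler_cong h) (simp_all add: H.m_assoc y linear_maps_closed[OF antipode_linear])
  \<comment> \<open>The unit factor is what remains of \<open>c S(d)\<close>:
    \<open>sweedler_antipode_right\<close> is applied to the linear map
    \<open>t \<mapsto> t (y b)\<close> and returns its value at the unit.\<close>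
  also have "\<dots> = tensor_lift K H (\<lambda>a b. \<epsilon> a \<odot>\<^bsub>H\<^esub> (\<one>\<^bsub>H\<^esub> \<otimes>\<^bsub>H\<^esub> (y \<otimes>\<^bsub>H\<^esub> b))) (\<Delta> h)"
    by (intro sweedler_cong h sweedler_antipode_right) (assumption | rule intros)+
  also have "\<dots> = \<one>\<^bsub>H\<^esub> \<otimes>\<^bsub>H\<^esub> (y \<otimes>\<^bsub>H\<^esub> h)"
    by (rule sweedler_counit_left[OF _ _ h]) (assumption | rule intros)+
  finally show ?thesis using y h by simp
qed

text \<open>In Sweedler form, \<open>f(h) = S(h1) h2 f(h3) = S(h1) y h2\<close>. Linearity of
  \<open>f\<close> lets the counit be introduced in front of it, and the crossed relation is used at
  the second leg of \<open>h\<close>, which is why it is assumed for all elements of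
  \<open>H\<close>.\<close>

lemma conjugation_of_crossed:
  assumes f: "f \<in> linear_maps K H H" and y: "y \<in> carrier H" and h: "h \<in> carrier H"
    and crossed: "\<And>h. h \<in> carrier H \<Longrightarrow> tensor_lift K H (\<lambda>a b. a \<otimes>\<^bsub>H\<^esub> f b) (\<Delta> h) = y \<otimes>\<^bsub>H\<^esub> h"
  shows "f h = tensor_lift K H (\<lambda>a b. S a \<otimes>\<^bsub>H\<^esub> y \<otimes>\<^bsub>H\<^esub> b) (\<Delta> h)"
proof -
  note intros = multilinear_intros hopf_intros y linear_maps_closed[OF f] linear_maps_comp[OF _ f]
  note closed = y linear_maps_closed[OF f] linear_maps_closed[OF antipode_linear]
  \<comment> \<open>The inserted unit is the value \<open>f \<one>\<close> expected by
    \<open>sweedler_antipode_left\<close>, which is next read backwards to create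
    \<open>S c \<otimes> d\<close>.\<close>
  have "f h = tensor_lift K H (\<lambda>a b. \<epsilon> a \<odot>\<^bsub>H\<^esub> (\<one>\<^bsub>H\<^esub> \<otimes>\<^bsub>H\<^esub> f b)) (\<Delta> h)"
    using sweedler_counit_left[OF module_axioms f h] closed by (simp cong: sweedler_cong add: h)
  also have "\<dots> = tensor_lift K H (\<lambda>a b. tensor_lift K H (\<lambda>c d. S c \<otimes>\<^bsub>H\<^esub> d \<otimes>\<^bsub>H\<^esub> f b) (\<Delta> a)) (\<Delta> h)"
    by (intro sweedler_cong h sweedler_antipode_left[symmetric]) (assumption | rule intros)+
  also have "\<dots> = tensor_lift K H (\<lambda>a b. tensor_lift K H (\<lambda>c d. S a \<otimes>\<^bsub>H\<^esub> c \<otimes>\<^bsub>H\<^esub> f d) (\<Delta> b)) (\<Delta> h)"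
    by (rule sweedler_coassoc[OF _ h, where T = "\<lambda>a c d. S a \<otimes>\<^bsub>H\<^esub> c \<otimes>\<^bsub>H\<^esub> f d"])
      (assumption | rule intros)+
  also have "\<dots> = tensor_lift K H (\<lambda>a b. tensor_lift K H (\<lambda>c d. S a \<otimes>\<^bsub>H\<^esub> (c \<otimes>\<^bsub>H\<^esub> f d)) (\<Delta> b)) (\<Delta> h)"
    by (intro sweedler_cong h) (simp_all add: H.m_assoc closed)
  also have "\<dots> = tensor_lift K H (\<lambda>a b. S a \<otimes>\<^bsub>H\<^esub> tensor_lift K H (\<lambda>c d. c \<otimes>\<^bsub>H\<^esub> f d) (\<Delta> b)) (\<Delta> h)"
    by (rule sweedler_cong[OF h], rule sweedler_hom[symmetric, OF _ _ bilinear_mapD1[OF mult_bilinear]])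
      (assumption | rule intros)+
  also have "\<dots> = tensor_lift K H (\<lambda>a b. S a \<otimes>\<^bsub>H\<^esub> y \<otimes>\<^bsub>H\<^esub> b) (\<Delta> h)"
    by (intro sweedler_cong h) (simp_all add: H.m_assoc closed crossed)
  finally show ?thesis .
qed

end

section \<open>The diagonal action, and comultiplication of \<open>act x h\<close>, under Sweedler
  sums\<close>

context module_coalgebra
begin

lemmas module_coalgebra_intros =
  H.hopf_intros X.coalgebra_intros act_bilinear bilinear_comp_left[OF act_bilinear]
  bilinear_comp_right[OF act_bilinear] bilinear_map_closed[OF act_bilinear]

lemma act_closed: "x \<in> carrier X \<Longrightarrow> h \<in> carrier H \<Longrightarrow> act x h \<in> carrier X"
  by (rule bilinear_map_closed[OF act_bilinear])

lemma diagonal_action_bilinear: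
  "bilinear_map K (tensor K X X) H (tensor K X X) (diagonal_action K X \<Delta>\<^sub>H act)"
  unfolding diagonal_action_def
  by (assumption | rule multilinear_intros module_coalgebra_intros)+

lemma diagonal_action_pure:
  assumes "x \<in> carrier X" "y \<in> carrier X" "h \<in> carrier H"
  shows "diagonal_action K X \<Delta>\<^sub>H act (pure_tensor K X X x y) h
    = tensor_lift K (tensor K X X) (\<lambda>a b. pure_tensor K X X (act x a) (act y b)) (\<Delta>\<^sub>H h)"
  unfolding diagonal_action_def
  by (rule tensor_lift_pure) (assumption | rule assms multilinear_intros module_coalgebra_intros)+

lemma sweedler_act:
  assumes P: "module K P" and B: "bilinear_map K X X P B" and x: "x \<in> carrier X" and h: "h \<in> carrier H"
  shows "tensor_lift K P B (\<Delta>\<^sub>X (act x h))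
    = tensor_lift K P (\<lambda>x\<^sub>1 x\<^sub>2. tensor_lift K P (\<lambda>h\<^sub>1 h\<^sub>2. B (act x\<^sub>1 h\<^sub>1) (act x\<^sub>2 h\<^sub>2)) (\<Delta>\<^sub>H h)) (\<Delta>\<^sub>X x)"
proof -
  note intros = P multilinear_intros module_coalgebra_intros x h
  note lin = tensor_lift_linear[OF X.module_axioms X.module_axioms P B]
  show ?thesis
    unfolding comult_act[OF x h] diagonal_action_def
    apply (subst X.sweedler_hom[OF _ _ lin _ x], (assumption | rule intros)+)
    apply (rule X.sweedler_cong[OF x])
    apply (subst H.sweedler_hom[OF _ _ lin _ h], (assumption | rule intros)+)
    apply (rule H.sweedler_cong[OF h])
    apply (rule tensor_lift_pure[OF _ _ P B], (assumption | rule intros)+)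
    done
qed

end

section \<open>The augmentation map under Sweedler sums, and its crossed relation\<close>

context categorical_augmented_rack
begin

lemmas rack_intros =
  module_coalgebra_intros linear_maps_comp[OF _ aug_linear] linear_maps_closed[OF aug_linear]

lemma aug_closed: "x \<in> carrier X \<Longrightarrow> \<nu> x \<in> carrier H"
  by (rule linear_maps_closed[OF aug_linear])

lemma sweedler_aug:
  assumes "module K P" "bilinear_map K H H P B" "x \<in> carrier X"
  shows "tensor_lift K P B (\<Delta>\<^sub>H (\<nu> x)) = tensor_lift K P (\<lambda>a b. B (\<nu> a) (\<nu> b)) (\<Delta>\<^sub>X x)"
  unfolding aug_comult[OF assms(3)]
  by (rule tensor_lift_map[OF _ _ _ _ _ aug_linear aug_linear])
    (assumption | rule assms rack_intros)+

lemma crossed: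
  assumes "x \<in> carrier X" "h \<in> carrier H"
  shows "tensor_lift K H (\<lambda>a b. a \<otimes>\<^bsub>H\<^esub> \<nu> (act x b)) (\<Delta>\<^sub>H h) = \<nu> x \<otimes>\<^bsub>H\<^esub> h"
  by (rule H.crossed_of_conjugation) (simp_all add: assms aug_act aug_closed)

text \<open>The left side has the legs in the order \<open>B h2 (h1 \<nu>(x h3))\<close>.
  Cocommutativity exchanges the first two, giving \<open>B h1 (h2 \<nu>(x h3))\<close>, and the
  crossed relation inside the second argument gives \<open>B h1 (\<nu>(x) h2)\<close>. The
  Yang-Baxter computation uses cocommutativity through this rule.\<close>

lemma sweedler_crossed:
  assumes cc: "cocommutative K H \<Delta>\<^sub>H" and P: "module K P" and B: "bilinear_map K H H P B"
    and x: "x \<in> carrier X" and h: "h \<in> carrier H"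
  shows "tensor_lift K P (\<lambda>a b. tensor_lift K P (\<lambda>c d. B c (a \<otimes>\<^bsub>H\<^esub> \<nu> (act x d))) (\<Delta>\<^sub>H b)) (\<Delta>\<^sub>H h)
    = tensor_lift K P (\<lambda>a b. B a (\<nu> x \<otimes>\<^bsub>H\<^esub> b)) (\<Delta>\<^sub>H h)"
proof -
  note intros = P multilinear_intros rack_intros x bilinear_comp_left[OF B] bilinear_comp_right[OF B]
  have "tensor_lift K P (\<lambda>a b. tensor_lift K P (\<lambda>c d. B c (a \<otimes>\<^bsub>H\<^esub> \<nu> (act x d))) (\<Delta>\<^sub>H b)) (\<Delta>\<^sub>H h)
    = tensor_lift K P (\<lambda>a b. tensor_lift K P (\<lambda>c d. B a (c \<otimes>\<^bsub>H\<^esub> \<nu> (act x d))) (\<Delta>\<^sub>H b)) (\<Delta>\<^sub>H h)"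
    by (rule H.sweedler_swap12[OF cc P h, where T = "\<lambda>a c d. B a (c \<otimes>\<^bsub>H\<^esub> \<nu> (act x d))"])
      (assumption | rule intros)+
  also have "\<dots> = tensor_lift K P (\<lambda>a b. B a (tensor_lift K H (\<lambda>c d. c \<otimes>\<^bsub>H\<^esub> \<nu> (act x d)) (\<Delta>\<^sub>H b))) (\<Delta>\<^sub>H h)"
    by (rule H.sweedler_cong[OF h], rule H.sweedler_hom[symmetric, OF _ _ bilinear_mapD1[OF B]])
      (assumption | rule intros)+
  also have "\<dots> = tensor_lift K P (\<lambda>a b. B a (\<nu> x \<otimes>\<^bsub>H\<^esub> b)) (\<Delta>\<^sub>H h)"
    by (rule H.sweedler_cong[OF h]) (simp add: crossed x)
  finally show ?thesis .
qed

end

section \<open>The Yang-Baxter equation for augmented racks\<close>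

context categorical_augmented_rack
begin

abbreviation "R_mat \<equiv> rack_R_matrix K X \<Delta>\<^sub>X act \<nu>"

lemma R_matrix_linear: "R_mat \<in> linear_maps K (tensor K X X) (tensor K X X)"
  unfolding rack_R_matrix_def
  by (rule tensor_lift_linear) (assumption | rule multilinear_intros rack_intros)+

lemma R_matrix_pure:
  assumes "u \<in> carrier X" "v \<in> carrier X"
  shows "R_mat (pure_tensor K X X u v)
    = tensor_lift K (tensor K X X) (\<lambda>v\<^sub>1 v\<^sub>2. pure_tensor K X X v\<^sub>1 (act u (\<nu> v\<^sub>2))) (\<Delta>\<^sub>X v)"
  unfolding rack_R_matrix_def
  by (rule tensor_lift_pure) (assumption | rule assms multilinear_intros rack_intros)+

theorem yang_baxter_R_matrix:
  assumes cc: "cocommutative K H \<Delta>\<^sub>H"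
  shows "yang_baxter K X R_mat"
proof -
  define Q where "Q = tensor K (tensor K X X) X"
  let ?XX = "tensor K X X"
  let ?L = "tensor_lift K Q"
  \<comment> \<open>\<open>p\<close> and \<open>Q\<close> hide the bracketing of the threefold
    tensor product: once \<open>R1\<close> and \<open>R2\<close> are known on
    \<open>p u v w\<close>, the computation treats \<open>p\<close> as an opaque trilinear
    map.\<close>
  define p where "p = (\<lambda>x y z. pure_tensor K ?XX X (pure_tensor K X X x y) z)"
  define R1 where "R1 = tensor_map K ?XX X R_mat id"
  define R2 where "R2 = tensor_assoc_inv K X X X \<circ> tensor_map K X ?XX id R_mat \<circ> tensor_assoc K X X X"
  note R_intros = multilinear_intros rack_intros linear_maps_comp[OF _ R_matrix_linear]
    linear_maps_closed[OF R_matrix_linear]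
  have Q: "module K Q"
    unfolding Q_def by (assumption | rule R_intros)+
  have p_closed: "p x y z \<in> carrier Q" if "x \<in> carrier X" "y \<in> carrier X" "z \<in> carrier X" for x y z
    unfolding p_def Q_def by (assumption | rule that R_intros)+
  \<comment> \<open>The source module stays arbitrary because the slots of \<open>p\<close> are
    filled with expressions whose variable ranges over \<open>X\<close> in some steps and over
    \<open>H\<close> in others.\<close>
  have p_lin: "(\<lambda>t. p (f t) y z) \<in> linear_maps K M Q" "(\<lambda>t. p x (f t) z) \<in> linear_maps K M Q"
    "(\<lambda>t. p x y (f t)) \<in> linear_maps K M Q"
    if "x \<in> carrier X" "y \<in> carrier X" "z \<in> carrier X" "f \<in> linear_maps K M X"
    for x y z f and M :: "('a, 'z, 'w) module_scheme"
    unfolding p_def Q_def by (assumption | rule that R_intros)+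
  have R1_lin: "R1 \<in> linear_maps K Q Q"
    unfolding R1_def Q_def
    by (rule tensor_map_linear) (assumption | rule R_intros R_matrix_linear linear_maps_id)+
  have R2_lin: "R2 \<in> linear_maps K Q Q"
    unfolding R2_def Q_def comp_def
    by (rule linear_maps_comp[OF linear_maps_comp[OF tensor_assoc_linear tensor_map_linear] tensor_assoc_inv_linear])
      (assumption | rule R_intros R_matrix_linear linear_maps_id)+
  note intros = Q p_closed p_lin R_intros
  have R1: "R1 (p u v w) = ?L (\<lambda>a b. p a (act u (\<nu> b)) w) (\<Delta>\<^sub>X v)"
    if "u \<in> carrier X" "v \<in> carrier X" "w \<in> carrier X" for u v w
  proof -
    have "R1 (p u v w) = pure_tensor K ?XX X (R_mat (pure_tensor K X X u v)) w"
      unfolding R1_def p_def using that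
      by (subst tensor_map_pure[OF _ _ _ _ R_matrix_linear linear_maps_id])
        (simp_all add: X.module_axioms module_tensor pure_tensor_closed)
    also have "\<dots> = ?L (\<lambda>a b. p a (act u (\<nu> b)) w) (\<Delta>\<^sub>X v)"
      unfolding R_matrix_pure[OF that(1,2)] p_def Q_def
      by (rule X.sweedler_hom[OF _ _ bilinear_mapD2[OF bilinear_pure_tensor]])
        (assumption | rule that R_intros)+
    finally show ?thesis .
  qed
  have R2: "R2 (p u v w) = ?L (\<lambda>a b. p u a (act v (\<nu> b))) (\<Delta>\<^sub>X w)"
    if "u \<in> carrier X" "v \<in> carrier X" "w \<in> carrier X" for u v w
  proof -
    have "tensor_assoc K X X X (p u v w) = pure_tensor K X ?XX u (pure_tensor K X X v w)"
      unfolding p_def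
      by (subst tensor_assoc_pure, (assumption | rule that R_intros)+)
        (rule tensor_lift_pure, (assumption | rule that R_intros)+)
    then have "R2 (p u v w) = tensor_assoc_inv K X X X (pure_tensor K X ?XX u (R_mat (pure_tensor K X X v w)))"
      unfolding R2_def using that
      by (simp add: tensor_map_pure[OF _ _ _ _ linear_maps_id R_matrix_linear]
          X.module_axioms module_tensor pure_tensor_closed)
    also have "\<dots> = ?L (\<lambda>y z. p u y z) (R_mat (pure_tensor K X X v w))"
      unfolding p_def Q_def
      by (rule tensor_assoc_inv_pure) (assumption | rule that R_intros)+
    also have "\<dots> = ?L (\<lambda>a b. ?L (\<lambda>y z. p u y z) (pure_tensor K X X a (act v (\<nu> b)))) (\<Delta>\<^sub>X w)"
      unfolding R_matrix_pure[OF that(2,3)]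
      by (rule X.sweedler_hom[OF _ _ tensor_lift_linear]) (assumption | rule that intros)+
    also have "\<dots> = ?L (\<lambda>a b. p u a (act v (\<nu> b))) (\<Delta>\<^sub>X w)"
      by (rule X.sweedler_cong[OF that(3)], rule tensor_lift_pure) (assumption | rule that intros)+
    finally show ?thesis .
  qed
  have push1: "R1 (?L B (\<Delta>\<^sub>X c)) = ?L (\<lambda>a b. R1 (B a b)) (\<Delta>\<^sub>X c)"
    and push2: "R2 (?L B (\<Delta>\<^sub>X c)) = ?L (\<lambda>a b. R2 (B a b)) (\<Delta>\<^sub>X c)"
    if "c \<in> carrier X" "bilinear_map K X X Q B" for B c
    by (rule X.sweedler_hom[OF Q Q R1_lin that(2,1)]) (rule X.sweedler_hom[OF Q Q R2_lin that(2,1)])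
  note closed = act_closed aug_closed X.comult_closed H.comult_closed
  have braid: "R1 (R2 (R1 (p u v w))) = R2 (R1 (R2 (p u v w)))"
    if u: "u \<in> carrier X" and v: "v \<in> carrier X" and w: "w \<in> carrier X" for u v w
  proof -
    let ?common = "?L (\<lambda>v1 v2. ?L (\<lambda>w1 w2. ?L (\<lambda>a b. p w1 (act v1 a) (act u (\<nu> v2 \<otimes>\<^bsub>H\<^esub> b)))
      (\<Delta>\<^sub>H (\<nu> w2))) (\<Delta>\<^sub>X w)) (\<Delta>\<^sub>X v)"
    note intros = u v w intros
    have "R1 (R2 (R1 (p u v w))) = R1 (?L (\<lambda>v1 v2. R2 (p v1 (act u (\<nu> v2)) w)) (\<Delta>\<^sub>X v))"
      unfolding R1[OF u v w] by (subst push2[OF v]) (assumption | rule intros refl)+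
    also have "\<dots> = R1 (?L (\<lambda>v1 v2. ?L (\<lambda>w1 w2. p v1 w1 (act (act u (\<nu> v2)) (\<nu> w2))) (\<Delta>\<^sub>X w)) (\<Delta>\<^sub>X v))"
      by (simp add: R2 u v w closed cong: X.sweedler_cong)
    also have "\<dots> = ?L (\<lambda>v1 v2. R1 (?L (\<lambda>w1 w2. p v1 w1 (act (act u (\<nu> v2)) (\<nu> w2))) (\<Delta>\<^sub>X w))) (\<Delta>\<^sub>X v)"
      by (rule push1[OF v]) (assumption | rule intros)+
    also have "\<dots> = ?L (\<lambda>v1 v2. ?L (\<lambda>w1 w2. R1 (p v1 w1 (act (act u (\<nu> v2)) (\<nu> w2)))) (\<Delta>\<^sub>X w)) (\<Delta>\<^sub>X v)"
      by (rule X.sweedler_cong[OF v], rule push1[OF w]) (assumption | rule intros)+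
    also have "\<dots> = ?L (\<lambda>v1 v2. ?L (\<lambda>w1 w2. ?L (\<lambda>a b.
        p a (act v1 (\<nu> b)) (act (act u (\<nu> v2)) (\<nu> w2))) (\<Delta>\<^sub>X w1)) (\<Delta>\<^sub>X w)) (\<Delta>\<^sub>X v)"
      by (simp add: R1 u v w closed cong: X.sweedler_cong)
    also have "\<dots> = ?L (\<lambda>v1 v2. ?L (\<lambda>w1 w2. ?L (\<lambda>a b.
        p w1 (act v1 (\<nu> a)) (act (act u (\<nu> v2)) (\<nu> b))) (\<Delta>\<^sub>X w2)) (\<Delta>\<^sub>X w)) (\<Delta>\<^sub>X v)"
      by (rule X.sweedler_cong[OF v], rule X.sweedler_coassoc[OF Q w,
          where T = "\<lambda>x y z. p x (act _ (\<nu> y)) (act (act u (\<nu> _)) (\<nu> z))"])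
        (assumption | rule intros)+
    \<comment> \<open>\<open>\<nu>\<close> is a coalgebra morphism, so the images of the two legs of
      \<open>w2\<close> are the two legs of \<open>\<nu> w2\<close>.\<close>
    also have "\<dots> = ?L (\<lambda>v1 v2. ?L (\<lambda>w1 w2. ?L (\<lambda>a b.
        p w1 (act v1 a) (act (act u (\<nu> v2)) b)) (\<Delta>\<^sub>H (\<nu> w2))) (\<Delta>\<^sub>X w)) (\<Delta>\<^sub>X v)"
      by (rule X.sweedler_cong[OF v], rule X.sweedler_cong[OF w], rule sweedler_aug[OF Q, symmetric])
        (assumption | rule intros)+
    also have "\<dots> = ?common"
      by (rule X.sweedler_cong[OF v], rule X.sweedler_cong[OF w])
        (simp add: act_mult u v w closed cong: H.sweedler_cong)
    finally have left: "R1 (R2 (R1 (p u v w))) = ?common" .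
    have "R2 (R1 (R2 (p u v w))) = R2 (?L (\<lambda>w1 w2. R1 (p u w1 (act v (\<nu> w2)))) (\<Delta>\<^sub>X w))"
      unfolding R2[OF u v w] by (subst push1[OF w]) (assumption | rule intros refl)+
    also have "\<dots> = R2 (?L (\<lambda>w1 w2. ?L (\<lambda>a b. p a (act u (\<nu> b)) (act v (\<nu> w2))) (\<Delta>\<^sub>X w1)) (\<Delta>\<^sub>X w))"
      by (simp add: R1 u v w closed cong: X.sweedler_cong)
    also have "\<dots> = R2 (?L (\<lambda>w1 w2. ?L (\<lambda>a b. p w1 (act u (\<nu> a)) (act v (\<nu> b))) (\<Delta>\<^sub>X w2)) (\<Delta>\<^sub>X w))"
      by (rule arg_cong[where f = R2], rule X.sweedler_coassoc[OF Q w,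
          where T = "\<lambda>x y z. p x (act u (\<nu> y)) (act v (\<nu> z))"])
        (assumption | rule intros)+
    also have "\<dots> = ?L (\<lambda>w1 w2. R2 (?L (\<lambda>a b. p w1 (act u (\<nu> a)) (act v (\<nu> b))) (\<Delta>\<^sub>X w2))) (\<Delta>\<^sub>X w)"
      by (rule push2[OF w]) (assumption | rule intros)+
    also have "\<dots> = ?L (\<lambda>w1 w2. ?L (\<lambda>a b. R2 (p w1 (act u (\<nu> a)) (act v (\<nu> b)))) (\<Delta>\<^sub>X w2)) (\<Delta>\<^sub>X w)"
      by (rule X.sweedler_cong[OF w], rule push2) (assumption | rule intros)+
    also have "\<dots> = ?L (\<lambda>w1 w2. ?L (\<lambda>a b. ?L (\<lambda>c d. p w1 c (act (act u (\<nu> a)) (\<nu> d)))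
        (\<Delta>\<^sub>X (act v (\<nu> b)))) (\<Delta>\<^sub>X w2)) (\<Delta>\<^sub>X w)"
      by (simp add: R2 u v w closed cong: X.sweedler_cong)
    \<comment> \<open>The legs of \<open>w2\<close> are traded for legs of \<open>\<nu> w2\<close>
      before \<open>\<Delta>\<^sub>X (act v b)\<close> is expanded, so that the expansion splits an
      element of \<open>H\<close> and yields three legs of one element.\<close>
    also have "\<dots> = ?L (\<lambda>w1 w2. ?L (\<lambda>a b. ?L (\<lambda>c d. p w1 c (act (act u a) (\<nu> d)))
        (\<Delta>\<^sub>X (act v b))) (\<Delta>\<^sub>H (\<nu> w2))) (\<Delta>\<^sub>X w)"
      by (rule X.sweedler_cong[OF w], rule sweedler_aug[OF Q, symmetric])
        (assumption | rule intros)+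
    also have "\<dots> = ?L (\<lambda>w1 w2. ?L (\<lambda>a b. ?L (\<lambda>v1 v2. ?L (\<lambda>c d.
        p w1 (act v1 c) (act (act u a) (\<nu> (act v2 d)))) (\<Delta>\<^sub>H b)) (\<Delta>\<^sub>X v)) (\<Delta>\<^sub>H (\<nu> w2))) (\<Delta>\<^sub>X w)"
      by (rule X.sweedler_cong[OF w], rule H.sweedler_cong[OF aug_closed], assumption, rule sweedler_act[OF Q])
        (assumption | rule intros)+
    \<comment> \<open>The sum over \<open>v\<close> moves outwards, so that the two sums over
      \<open>H\<close> become adjacent and match \<open>sweedler_crossed\<close>.\<close>
    also have "\<dots> = ?L (\<lambda>w1 w2. ?L (\<lambda>v1 v2. ?L (\<lambda>a b. ?L (\<lambda>c d.
        p w1 (act v1 c) (act (act u a) (\<nu> (act v2 d)))) (\<Delta>\<^sub>H b)) (\<Delta>\<^sub>H (\<nu> w2))) (\<Delta>\<^sub>X v)) (\<Delta>\<^sub>X w)"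
      by (rule X.sweedler_cong[OF w], rule tensor_lift_swap[of K H H X X])
        (assumption | rule intros)+
    also have "\<dots> = ?L (\<lambda>w1 w2. ?L (\<lambda>v1 v2. ?L (\<lambda>a b. ?L (\<lambda>c d.
        p w1 (act v1 c) (act u (a \<otimes>\<^bsub>H\<^esub> \<nu> (act v2 d)))) (\<Delta>\<^sub>H b)) (\<Delta>\<^sub>H (\<nu> w2))) (\<Delta>\<^sub>X v)) (\<Delta>\<^sub>X w)"
      by (rule X.sweedler_cong[OF w], rule X.sweedler_cong[OF v])
        (simp add: act_mult u v w closed cong: H.sweedler_cong)
    \<comment> \<open>\<open>sweedler_crossed\<close> at \<open>v2\<close> and
      \<open>\<nu> w2\<close>; the first argument of \<open>B\<close> is the leg acting on
      \<open>v1\<close>, the second is the product acting on \<open>u\<close>.\<close>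
    also have "\<dots> = ?L (\<lambda>w1 w2. ?L (\<lambda>v1 v2. ?L (\<lambda>a b.
        p w1 (act v1 a) (act u (\<nu> v2 \<otimes>\<^bsub>H\<^esub> b))) (\<Delta>\<^sub>H (\<nu> w2))) (\<Delta>\<^sub>X v)) (\<Delta>\<^sub>X w)"
      by (rule X.sweedler_cong[OF w], rule X.sweedler_cong[OF v],
          rule sweedler_crossed[OF cc Q, where B = "\<lambda>c h. p _ (act _ c) (act u h)"])
        (assumption | rule intros)+
    also have "\<dots> = ?common"
      by (rule tensor_lift_swap[of K X X X X]) (assumption | rule intros)+
    finally show ?thesis using left by simp
  qed
  \<comment> \<open>Extensionality is needed twice: the left factor \<open>s\<close> of a pure
    tensor in \<open>Q\<close> is itself an arbitrary element of
    \<open>X \<otimes> X\<close>.\<close>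
  have "R1 (R2 (R1 z)) = R2 (R1 (R2 z))" if z: "z \<in> carrier Q" for z
  proof (rule tensor_ext[OF _ _ _ _ _ z[unfolded Q_def]])
    show "(\<lambda>z. R1 (R2 (R1 z))) \<in> linear_maps K (tensor K ?XX X) Q"
      and "(\<lambda>z. R2 (R1 (R2 z))) \<in> linear_maps K (tensor K ?XX X) Q"
      using linear_maps_comp[OF linear_maps_comp[OF R1_lin R2_lin] R1_lin]
        linear_maps_comp[OF linear_maps_comp[OF R2_lin R1_lin] R2_lin] by (simp_all add: Q_def)
    fix s w assume s: "s \<in> carrier ?XX" and w: "w \<in> carrier X"
    have lin': "(\<lambda>s. pure_tensor K ?XX X s w) \<in> linear_maps K ?XX Q"
      unfolding Q_def by (assumption | rule w R_intros)+
    show "R1 (R2 (R1 (pure_tensor K ?XX X s w))) = R2 (R1 (R2 (pure_tensor K ?XX X s w)))"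
      by (rule tensor_ext[OF _ _ _ _ _ s])
        (use braid w in \<open>auto simp: X.module_axioms p_def
          intro!: linear_maps_comp[OF linear_maps_comp[OF linear_maps_comp[OF lin' R1_lin] R2_lin] R1_lin]
            linear_maps_comp[OF linear_maps_comp[OF linear_maps_comp[OF lin' R2_lin] R1_lin] R2_lin]\<close>)
  qed (assumption | rule R_intros)+
  then show ?thesis
    unfolding yang_baxter_def Let_def R1_def R2_def Q_def by simp
qed

end

section \<open>Tensor squares\<close>

text \<open>The map \<open>\<epsilon> \<otimes> \<epsilon>\<close> followed by the identification of
  \<open>K \<otimes> K\<close> with \<open>K\<close>; it makes the square a coalgebra. The product
  in \<open>K\<close> is written as the scalar action on \<open>ring_as_module K\<close>, which is
  the form the linearity rules recognise.\<close>

definition tensor_counit ::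
  "('k, 'r) ring_scheme \<Rightarrow> ('c \<Rightarrow> 'k) \<Rightarrow> ('c \<times> 'c \<Rightarrow> 'k) set \<Rightarrow> 'k"
  where "tensor_counit K \<epsilon> = tensor_lift K (ring_as_module K) (\<lambda>x y. \<epsilon> x \<odot>\<^bsub>ring_as_module K\<^esub> \<epsilon> y)"

section \<open>The coalgebra structure on the tensor square\<close>

context coalgebra
begin

lemma ring_module: "module K (ring_as_module K)"
  by (rule module_ring_as_module) (rule R.is_cring)

lemma tensor_comult_linear:
  "tensor_comult K C \<Delta> \<in> linear_maps K (tensor K C C) (tensor K (tensor K C C) (tensor K C C))"
  unfolding tensor_comult_def comp_def
  by (rule linear_maps_comp[OF tensor_map_linear tensor_middle_flip_linear])
    (assumption | rule comult_linear multilinear_intros coalgebra_intros)+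

lemma tensor_counit_linear: "tensor_counit K \<epsilon> \<in> linear_maps K (tensor K C C) (ring_as_module K)"
  unfolding tensor_counit_def
  by (rule tensor_lift_linear) (assumption | rule ring_module multilinear_intros coalgebra_intros)+

lemma tensor_counit_pure:
  assumes "x \<in> carrier C" "y \<in> carrier C"
  shows "tensor_counit K \<epsilon> (pure_tensor K C C x y) = \<epsilon> x \<otimes>\<^bsub>K\<^esub> \<epsilon> y"
proof -
  have "tensor_counit K \<epsilon> (pure_tensor K C C x y) = \<epsilon> x \<odot>\<^bsub>ring_as_module K\<^esub> \<epsilon> y"
    unfolding tensor_counit_def
    by (rule tensor_lift_pure) (assumption | rule assms ring_module multilinear_intros coalgebra_intros)+
  then show ?thesis by (simp add: ring_as_module_def)
qed

lemmas tensor_coalgebra_intros =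
  ring_module coalgebra_intros linear_maps_comp[OF _ tensor_comult_linear] linear_maps_closed[OF tensor_comult_linear]
  linear_maps_comp[OF _ tensor_counit_linear] linear_maps_closed[OF tensor_counit_linear]

lemma tensor_comult_pure:
  assumes x: "x \<in> carrier C" and y: "y \<in> carrier C"
  defines "T \<equiv> tensor K (tensor K C C) (tensor K C C)"
  shows "tensor_comult K C \<Delta> (pure_tensor K C C x y)
    = tensor_lift K T (\<lambda>a b. tensor_lift K T (\<lambda>c d.
        pure_tensor K (tensor K C C) (tensor K C C) (pure_tensor K C C a c) (pure_tensor K C C b d)) (\<Delta> y)) (\<Delta> x)"
  unfolding tensor_comult_def T_def
  by (simp add: tensor_map_pure[OF _ _ _ _ comult_linear comult_linear] tensor_middle_flip_pure
      module_axioms module_tensor comult_closed x y)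

lemma sweedler_tensor:
  assumes P: "module K P" and B: "bilinear_map K (tensor K C C) (tensor K C C) P B"
    and x: "x \<in> carrier C" and y: "y \<in> carrier C"
  shows "tensor_lift K P B (tensor_comult K C \<Delta> (pure_tensor K C C x y))
    = tensor_lift K P (\<lambda>a b. tensor_lift K P (\<lambda>c d. B (pure_tensor K C C a c) (pure_tensor K C C b d)) (\<Delta> y)) (\<Delta> x)"
proof -
  note intros = P multilinear_intros coalgebra_intros x y
  note lin = tensor_lift_linear[OF module_tensor[OF module_axioms module_axioms]
      module_tensor[OF module_axioms module_axioms] P B]
  show ?thesis
    unfolding tensor_comult_pure[OF x y]
    apply (subst sweedler_hom[OF _ _ lin _ x], (assumption | rule intros)+)
    apply (rule sweedler_cong[OF x])
    apply (subst sweedler_hom[OF _ _ lin _ y], (assumption | rule intros)+)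
    apply (rule sweedler_cong[OF y])
    apply (rule tensor_lift_pure[OF _ _ P B], (assumption | rule intros)+)
    done
qed

text \<open>Coassociativity is used in each factor separately. Exchanging the sums over
  \<open>y\<close> and over the first leg of \<open>x\<close> makes the two sums over
  \<open>y\<close> adjacent; coassociativity for \<open>y\<close>, then for \<open>x\<close>, and
  the opposite exchange finish. Linearity of \<open>T\<close> is assumed along maps \<open>f\<close>
  from \<open>C\<close> into the square, since the arguments of \<open>T\<close> are pure tensors in
  which one variable of \<open>C\<close> moves at a time.\<close>

lemma tensor_coassoc:
  assumes P: "module K P"
    and T: "\<And>y z f. f \<in> linear_maps K C (tensor K C C) \<Longrightarrow> y \<in> carrier (tensor K C C) \<Longrightarrow> z \<in> carrier (tensor K C C) \<Longrightarrow>
        (\<lambda>t. T (f t) y z) \<in> linear_maps K C P"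
      "\<And>x z f. x \<in> carrier (tensor K C C) \<Longrightarrow> f \<in> linear_maps K C (tensor K C C) \<Longrightarrow> z \<in> carrier (tensor K C C) \<Longrightarrow>
        (\<lambda>t. T x (f t) z) \<in> linear_maps K C P"
      "\<And>x y f. x \<in> carrier (tensor K C C) \<Longrightarrow> y \<in> carrier (tensor K C C) \<Longrightarrow> f \<in> linear_maps K C (tensor K C C) \<Longrightarrow>
        (\<lambda>t. T x y (f t)) \<in> linear_maps K C P"
    and x: "x \<in> carrier C" and y: "y \<in> carrier C"
  defines "p \<equiv> pure_tensor K C C"
  shows "tensor_lift K P (\<lambda>a b. tensor_lift K P (\<lambda>a' b'. tensor_lift K P (\<lambda>c d. tensor_lift K P
        (\<lambda>c' d'. T (p c c') (p d d') (p b b')) (\<Delta> a')) (\<Delta> a)) (\<Delta> y)) (\<Delta> x)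
    = tensor_lift K P (\<lambda>a b. tensor_lift K P (\<lambda>a' b'. tensor_lift K P (\<lambda>c d. tensor_lift K P
        (\<lambda>c' d'. T (p a a') (p c c') (p d d')) (\<Delta> b')) (\<Delta> b)) (\<Delta> y)) (\<Delta> x)"
proof -
  let ?L = "tensor_lift K P"
  note intros = P x y T multilinear_intros coalgebra_intros
  have "?L (\<lambda>a b. ?L (\<lambda>a' b'. ?L (\<lambda>c d. ?L (\<lambda>c' d'. T (p c c') (p d d') (p b b')) (\<Delta> a')) (\<Delta> a)) (\<Delta> y)) (\<Delta> x)
      = ?L (\<lambda>a b. ?L (\<lambda>c d. ?L (\<lambda>a' b'. ?L (\<lambda>c' d'. T (p c c') (p d d') (p b b')) (\<Delta> a')) (\<Delta> y)) (\<Delta> a)) (\<Delta> x)"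
    unfolding p_def
    by (rule sweedler_cong[OF x], rule tensor_lift_swap[of K C C C C]) (assumption | rule intros)+
  also have "\<dots> = ?L (\<lambda>a b. ?L (\<lambda>c d. ?L (\<lambda>a' b'. ?L (\<lambda>c' d'. T (p c a') (p d c') (p b d')) (\<Delta> b')) (\<Delta> y)) (\<Delta> a)) (\<Delta> x)"
    unfolding p_def
    by (rule sweedler_cong[OF x], rule sweedler_cong, assumption,
        rule sweedler_coassoc[OF P y]) (assumption | rule intros)+
  also have "\<dots> = ?L (\<lambda>a b. ?L (\<lambda>c d. ?L (\<lambda>a' b'. ?L (\<lambda>c' d'. T (p a a') (p c c') (p d d')) (\<Delta> b')) (\<Delta> y)) (\<Delta> b)) (\<Delta> x)"
    unfolding p_def
    by (rule sweedler_coassoc[OF P x, where T = "\<lambda>c d b. ?L (\<lambda>a' b'. ?L (\<lambda>c' d'.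
          T (pure_tensor K C C c a') (pure_tensor K C C d c') (pure_tensor K C C b d')) (\<Delta> b')) (\<Delta> y)"])
      (assumption | rule intros)+
  also have "\<dots> = ?L (\<lambda>a b. ?L (\<lambda>a' b'. ?L (\<lambda>c d. ?L (\<lambda>c' d'. T (p a a') (p c c') (p d d')) (\<Delta> b')) (\<Delta> b)) (\<Delta> y)) (\<Delta> x)"
    unfolding p_def
    by (rule sweedler_cong[OF x], rule tensor_lift_swap[of K C C C C]) (assumption | rule intros)+
  finally show ?thesis .
qed

lemma tensor_square_coalgebra:
  "coalgebra K (tensor K C C) (tensor_comult K C \<Delta>) (tensor_counit K \<epsilon>)"
proof -
  let ?Y = "tensor K C C"
  let ?D = "tensor_comult K C \<Delta>"
  let ?e = "tensor_counit K \<epsilon>"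
  let ?T = "tensor K ?Y (tensor K ?Y ?Y)"
  let ?q = "\<lambda>x y z. pure_tensor K ?Y (tensor K ?Y ?Y) x (pure_tensor K ?Y ?Y y z)"
  note intros = multilinear_intros tensor_coalgebra_intros
  interpret Y: module K ?Y by (rule intros)+
  have eps: "\<epsilon> x \<in> carrier K" if "x \<in> carrier C" for x
    using linear_maps_closed[OF counit_linear that] by (simp add: ring_as_module_def)
  show ?thesis
  proof (intro coalgebra.intro coalgebra_axioms.intro Y.module_axioms tensor_comult_linear tensor_counit_linear)
    fix z assume z: "z \<in> carrier ?Y"
    have "tensor_lift K ?T (\<lambda>a b. tensor_lift K ?T (\<lambda>c d. ?q c d b) (?D a)) (?D z)
        = tensor_lift K ?T (\<lambda>a b. tensor_lift K ?T (\<lambda>c d. ?q a c d) (?D b)) (?D z)"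
    proof (rule tensor_ext[OF module_axioms module_axioms _ _ _ z])
      fix x y assume x: "x \<in> carrier C" and y: "y \<in> carrier C"
      note intros = x y intros
      let ?p = "pure_tensor K C C"
      have "tensor_lift K ?T (\<lambda>a b. tensor_lift K ?T (\<lambda>c d. ?q c d b) (?D a)) (?D (?p x y))
          = tensor_lift K ?T (\<lambda>a b. tensor_lift K ?T (\<lambda>a' b'. tensor_lift K ?T (\<lambda>c d. ?q c d (?p b b'))
              (?D (?p a a'))) (\<Delta> y)) (\<Delta> x)"
        by (rule sweedler_tensor) (assumption | rule intros)+
      also have "\<dots> = tensor_lift K ?T (\<lambda>a b. tensor_lift K ?T (\<lambda>a' b'. tensor_lift K ?T (\<lambda>c d. tensor_lift K ?T
          (\<lambda>c' d'. ?q (?p c c') (?p d d') (?p b b')) (\<Delta> a')) (\<Delta> a)) (\<Delta> y)) (\<Delta> x)"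
        by (rule sweedler_cong[OF x], rule sweedler_cong[OF y], rule sweedler_tensor)
          (assumption | rule intros)+
      also have "\<dots> = tensor_lift K ?T (\<lambda>a b. tensor_lift K ?T (\<lambda>a' b'. tensor_lift K ?T (\<lambda>c d. tensor_lift K ?T
          (\<lambda>c' d'. ?q (?p a a') (?p c c') (?p d d')) (\<Delta> b')) (\<Delta> b)) (\<Delta> y)) (\<Delta> x)"
        by (rule tensor_coassoc) (assumption | rule intros)+
      also have "\<dots> = tensor_lift K ?T (\<lambda>a b. tensor_lift K ?T (\<lambda>a' b'. tensor_lift K ?T (\<lambda>c d. ?q (?p a a') c d)
              (?D (?p b b'))) (\<Delta> y)) (\<Delta> x)"
        by (rule sweedler_cong[OF x], rule sweedler_cong[OF y], rule sweedler_tensor[symmetric])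
          (assumption | rule intros)+
      also have "\<dots> = tensor_lift K ?T (\<lambda>a b. tensor_lift K ?T (\<lambda>c d. ?q a c d) (?D b)) (?D (?p x y))"
        by (rule sweedler_tensor[symmetric]) (assumption | rule intros)+
      finally show "tensor_lift K ?T (\<lambda>a b. tensor_lift K ?T (\<lambda>c d. ?q c d b) (?D a)) (?D (?p x y))
        = tensor_lift K ?T (\<lambda>a b. tensor_lift K ?T (\<lambda>c d. ?q a c d) (?D b)) (?D (?p x y))" .
    qed (assumption | rule intros)+
    then show "tensor_assoc K ?Y ?Y ?Y (tensor_map K (tensor K ?Y ?Y) ?Y ?D id (?D z))
        = tensor_map K ?Y (tensor K ?Y ?Y) id ?D (?D z)"
      by (simp only: tensor_assoc_comult_left[OF Y.module_axioms tensor_comult_linear]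
          tensor_map_comult_right[OF Y.module_axioms tensor_comult_linear]
          linear_maps_closed[OF tensor_comult_linear] z)
    show "tensor_lift K ?Y (\<lambda>a b. ?e a \<odot>\<^bsub>?Y\<^esub> b) (?D z) = z"
    proof (rule tensor_ext[OF module_axioms module_axioms _ linear_id _ z])
      fix x y assume x: "x \<in> carrier C" and y: "y \<in> carrier C"
      note intros = x y intros
      let ?p = "pure_tensor K C C"
      have "tensor_lift K ?Y (\<lambda>a b. ?e a \<odot>\<^bsub>?Y\<^esub> b) (?D (?p x y))
          = tensor_lift K ?Y (\<lambda>a b. tensor_lift K ?Y (\<lambda>c d. ?e (?p a c) \<odot>\<^bsub>?Y\<^esub> ?p b d) (\<Delta> y)) (\<Delta> x)"
        by (rule sweedler_tensor) (assumption | rule intros)+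
      \<comment> \<open>Commutativity of \<open>K\<close> puts the counit that belongs to
        \<open>y\<close> outside, so that the inner sum cancels while \<open>a\<close> and
        \<open>b\<close> are fixed.\<close>
      also have "\<dots> = tensor_lift K ?Y (\<lambda>a b. tensor_lift K ?Y (\<lambda>c d. \<epsilon> c \<odot>\<^bsub>?Y\<^esub> (\<epsilon> a \<odot>\<^bsub>?Y\<^esub> ?p b d)) (\<Delta> y)) (\<Delta> x)"
        by (rule sweedler_cong[OF x], rule sweedler_cong[OF y])
          (simp add: tensor_counit_pure eps Y.smult_assoc1[symmetric] m_comm pure_tensor_closed module_axioms)
      also have "\<dots> = tensor_lift K ?Y (\<lambda>a b. \<epsilon> a \<odot>\<^bsub>?Y\<^esub> ?p b y) (\<Delta> x)"
        by (rule sweedler_cong[OF x], rule sweedler_counit_left) (assumption | rule intros)+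
      also have "\<dots> = ?p x y"
        by (rule sweedler_counit_left) (assumption | rule intros)+
      finally show "tensor_lift K ?Y (\<lambda>a b. ?e a \<odot>\<^bsub>?Y\<^esub> b) (?D (?p x y)) = ?p x y" .
    qed (assumption | rule intros)+
    show "tensor_lift K ?Y (\<lambda>a b. ?e b \<odot>\<^bsub>?Y\<^esub> a) (?D z) = z"
    proof (rule tensor_ext[OF module_axioms module_axioms _ linear_id _ z])
      fix x y assume x: "x \<in> carrier C" and y: "y \<in> carrier C"
      note intros = x y intros
      let ?p = "pure_tensor K C C"
      have "tensor_lift K ?Y (\<lambda>a b. ?e b \<odot>\<^bsub>?Y\<^esub> a) (?D (?p x y))
          = tensor_lift K ?Y (\<lambda>a b. tensor_lift K ?Y (\<lambda>c d. ?e (?p b d) \<odot>\<^bsub>?Y\<^esub> ?p a c) (\<Delta> y)) (\<Delta> x)"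
        by (rule sweedler_tensor) (assumption | rule intros)+
      also have "\<dots> = tensor_lift K ?Y (\<lambda>a b. tensor_lift K ?Y (\<lambda>c d. \<epsilon> d \<odot>\<^bsub>?Y\<^esub> (\<epsilon> b \<odot>\<^bsub>?Y\<^esub> ?p a c)) (\<Delta> y)) (\<Delta> x)"
        by (rule sweedler_cong[OF x], rule sweedler_cong[OF y])
          (simp add: tensor_counit_pure eps Y.smult_assoc1[symmetric] m_comm pure_tensor_closed module_axioms)
      also have "\<dots> = tensor_lift K ?Y (\<lambda>a b. \<epsilon> b \<odot>\<^bsub>?Y\<^esub> ?p a y) (\<Delta> x)"
        by (rule sweedler_cong[OF x], rule sweedler_counit_right) (assumption | rule intros)+
      also have "\<dots> = ?p x y"
        by (rule sweedler_counit_right) (assumption | rule intros)+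
      finally show "tensor_lift K ?Y (\<lambda>a b. ?e b \<odot>\<^bsub>?Y\<^esub> a) (?D (?p x y)) = ?p x y" .
    qed (assumption | rule intros)+
  qed
qed

end

section \<open>The diagonal action on the tensor square\<close>

context module_coalgebra
begin

lemmas diagonal_intros =
  module_coalgebra_intros X.tensor_coalgebra_intros bilinear_comp_left[OF diagonal_action_bilinear]
  bilinear_comp_right[OF diagonal_action_bilinear] bilinear_map_closed[OF diagonal_action_bilinear]

text \<open>The unit and product laws come from multiplicativity and unitality of
  \<open>\<Delta>\<^sub>H\<close>. For compatibility with the comultiplication, the left side
  distributes four legs of \<open>g\<close> as \<open>(x1 g1, y1 g3)\<close> and
  \<open>(x2 g2, y2 g4)\<close>, whereas the right side has \<open>(x1 g1, y1 g2)\<close> and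
  \<open>(x2 g3, y2 g4)\<close>; cocommutativity identifies the two.\<close>

lemma tensor_square_module_coalgebra:
  assumes cc: "cocommutative K H \<Delta>\<^sub>H"
  shows "module_coalgebra K H \<Delta>\<^sub>H \<epsilon>\<^sub>H S (tensor K X X) (tensor_comult K X \<Delta>\<^sub>X) (tensor_counit K \<epsilon>\<^sub>X)
    (diagonal_action K X \<Delta>\<^sub>H act)"
proof -
  let ?Y = "tensor K X X"
  let ?D = "tensor_comult K X \<Delta>\<^sub>X"
  let ?act = "diagonal_action K X \<Delta>\<^sub>H act"
  let ?p = "pure_tensor K X X"
  note X = X.module_axioms X.module_axioms
  note intros = multilinear_intros diagonal_intros
  interpret Y: module K ?Y by (rule intros)+
  show ?thesis
  proof (intro module_coalgebra.intro module_coalgebra_axioms.intro H.hopf_algebra_axioms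
      X.tensor_square_coalgebra diagonal_action_bilinear)
    fix z assume z: "z \<in> carrier ?Y"
    show "?act z \<one>\<^bsub>H\<^esub> = z"
    proof (rule tensor_ext[OF X _ linear_id _ z])
      fix x y assume x: "x \<in> carrier X" and y: "y \<in> carrier X"
      have "?act (?p x y) \<one>\<^bsub>H\<^esub> = ?p (act x \<one>\<^bsub>H\<^esub>) (act y \<one>\<^bsub>H\<^esub>)"
        unfolding diagonal_action_pure[OF x y H.H.one_closed] H.comult_one
        by (rule tensor_lift_pure) (assumption | rule x y intros)+
      then show "?act (?p x y) \<one>\<^bsub>H\<^esub> = ?p x y" by (simp add: act_one x y)
    qed (assumption | rule intros)+
    fix g assume g: "g \<in> carrier H"
    {
      fix h assume h: "h \<in> carrier H"
      show "?act z (g \<otimes>\<^bsub>H\<^esub> h) = ?act (?act z g) h"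
      proof (rule tensor_ext[OF X _ _ _ z])
        fix x y assume x: "x \<in> carrier X" and y: "y \<in> carrier X"
        note intros = x y g h intros
        have "?act (?p x y) (g \<otimes>\<^bsub>H\<^esub> h) = tensor_lift K ?Y (\<lambda>a b. tensor_lift K ?Y
            (\<lambda>c d. ?p (act x (a \<otimes>\<^bsub>H\<^esub> c)) (act y (b \<otimes>\<^bsub>H\<^esub> d))) (\<Delta>\<^sub>H h)) (\<Delta>\<^sub>H g)"
          unfolding diagonal_action_pure[OF x y H.H.m_closed[OF g h]]
          by (rule H.sweedler_mult) (assumption | rule intros)+
        also have "\<dots> = tensor_lift K ?Y (\<lambda>a b. ?act (?p (act x a) (act y b)) h) (\<Delta>\<^sub>H g)"
          by (intro H.sweedler_cong[OF g])
            (simp add: diagonal_action_pure act_mult act_closed x y g h cong: H.sweedler_cong)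
        also have "\<dots> = ?act (?act (?p x y) g) h"
          unfolding diagonal_action_pure[OF x y g]
          by (rule H.sweedler_hom[symmetric, OF _ _ bilinear_mapD2[OF diagonal_action_bilinear]])
            (assumption | rule intros)+
        finally show "?act (?p x y) (g \<otimes>\<^bsub>H\<^esub> h) = ?act (?act (?p x y) g) h" .
      qed (assumption | rule g h intros)+
    }
    let ?YY = "tensor K ?Y ?Y"
    let ?L = "tensor_lift K ?YY"
    let ?q = "pure_tensor K ?Y ?Y"
    have "?D (?act z g) = ?L (\<lambda>u v. ?L (\<lambda>g\<^sub>1 g\<^sub>2. ?q (?act u g\<^sub>1) (?act v g\<^sub>2)) (\<Delta>\<^sub>H g)) (?D z)"
    proof (rule tensor_ext[OF X _ _ _ z])
      fix x y assume x: "x \<in> carrier X" and y: "y \<in> carrier X"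
      note intros = x y g intros
      \<comment> \<open>The last four arguments are listed by position in the result:
        \<open>i\<close>, \<open>j\<close> act in the first copy of the square and \<open>k\<close>,
        \<open>l\<close> in the second. The discrepancy between the two sides is thus an exchange of
        the middle two.\<close>
      let ?t = "\<lambda>a b c d i j k l. ?q (?p (act a i) (act c j)) (?p (act b k) (act d l))"
      have "?D (?act (?p x y) g) = ?L (\<lambda>i j. ?D (?p (act x i) (act y j))) (\<Delta>\<^sub>H g)"
        unfolding diagonal_action_pure[OF x y g]
        by (rule H.sweedler_hom[OF _ _ X.tensor_comult_linear]) (assumption | rule intros)+
      also have "\<dots> = ?L (\<lambda>i j. ?L (\<lambda>a b. ?L (\<lambda>c d. ?q (?p a c) (?p b d)) (\<Delta>\<^sub>X (act y j))) (\<Delta>\<^sub>X (act x i))) (\<Delta>\<^sub>H g)"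
        by (rule H.sweedler_cong[OF g], rule X.tensor_comult_pure) (assumption | rule intros)+
      also have "\<dots> = ?L (\<lambda>i j. ?L (\<lambda>a b. ?L (\<lambda>i1 i2. ?L (\<lambda>c d. ?q (?p (act a i1) c) (?p (act b i2) d))
          (\<Delta>\<^sub>X (act y j))) (\<Delta>\<^sub>H i)) (\<Delta>\<^sub>X x)) (\<Delta>\<^sub>H g)"
        by (rule H.sweedler_cong[OF g], rule sweedler_act) (assumption | rule intros)+
      also have "\<dots> = ?L (\<lambda>i j. ?L (\<lambda>a b. ?L (\<lambda>i1 i2. ?L (\<lambda>c d. ?L (\<lambda>j1 j2. ?t a b c d i1 j1 i2 j2)
          (\<Delta>\<^sub>H j)) (\<Delta>\<^sub>X y)) (\<Delta>\<^sub>H i)) (\<Delta>\<^sub>X x)) (\<Delta>\<^sub>H g)"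
        by (rule H.sweedler_cong[OF g], rule X.sweedler_cong[OF x], rule H.sweedler_cong, assumption,
            rule sweedler_act) (assumption | rule intros)+
      \<comment> \<open>This and the next two exchanges move all sums over legs of \<open>g\<close>
        inside those over \<open>x\<close> and \<open>y\<close>, as \<open>sweedler_swap23\<close>
        requires.\<close>
      also have "\<dots> = ?L (\<lambda>i j. ?L (\<lambda>a b. ?L (\<lambda>c d. ?L (\<lambda>i1 i2. ?L (\<lambda>j1 j2. ?t a b c d i1 j1 i2 j2)
          (\<Delta>\<^sub>H j)) (\<Delta>\<^sub>H i)) (\<Delta>\<^sub>X y)) (\<Delta>\<^sub>X x)) (\<Delta>\<^sub>H g)"
        by (rule H.sweedler_cong[OF g], rule X.sweedler_cong[OF x], rule tensor_lift_swap[of K H H X X])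
          (assumption | rule intros)+
      also have "\<dots> = ?L (\<lambda>a b. ?L (\<lambda>i j. ?L (\<lambda>c d. ?L (\<lambda>i1 i2. ?L (\<lambda>j1 j2. ?t a b c d i1 j1 i2 j2)
          (\<Delta>\<^sub>H j)) (\<Delta>\<^sub>H i)) (\<Delta>\<^sub>X y)) (\<Delta>\<^sub>H g)) (\<Delta>\<^sub>X x)"
        by (rule tensor_lift_swap[of K H H X X]) (assumption | rule intros)+
      also have "\<dots> = ?L (\<lambda>a b. ?L (\<lambda>c d. ?L (\<lambda>i j. ?L (\<lambda>i1 i2. ?L (\<lambda>j1 j2. ?t a b c d i1 j1 i2 j2)
          (\<Delta>\<^sub>H j)) (\<Delta>\<^sub>H i)) (\<Delta>\<^sub>H g)) (\<Delta>\<^sub>X y)) (\<Delta>\<^sub>X x)"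
        by (rule X.sweedler_cong[OF x], rule tensor_lift_swap[of K H H X X]) (assumption | rule intros)+
      also have "\<dots> = ?L (\<lambda>a b. ?L (\<lambda>c d. ?L (\<lambda>i j. ?L (\<lambda>i1 i2. ?L (\<lambda>j1 j2. ?t a b c d i1 i2 j1 j2)
          (\<Delta>\<^sub>H j)) (\<Delta>\<^sub>H i)) (\<Delta>\<^sub>H g)) (\<Delta>\<^sub>X y)) (\<Delta>\<^sub>X x)"
        by (rule X.sweedler_cong[OF x], rule X.sweedler_cong[OF y],
            rule H.sweedler_swap23[OF cc _ g, where T = "\<lambda>i j k l. ?t _ _ _ _ i j k l"])
          (assumption | rule intros)+
      also have "\<dots> = ?L (\<lambda>a b. ?L (\<lambda>c d. ?L (\<lambda>i j. ?L (\<lambda>i1 i2. ?q (?p (act a i1) (act c i2)) (?act (?p b d) j))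
          (\<Delta>\<^sub>H i)) (\<Delta>\<^sub>H g)) (\<Delta>\<^sub>X y)) (\<Delta>\<^sub>X x)"
        apply (rule X.sweedler_cong[OF x], rule X.sweedler_cong[OF y], rule H.sweedler_cong[OF g], rule H.sweedler_cong, assumption)
        apply (subst diagonal_action_pure, assumption+)
        apply (rule H.sweedler_hom[symmetric, OF _ _ bilinear_mapD1[OF bilinear_pure_tensor]], (assumption | rule intros)+)
        done
      \<comment> \<open>Only the action on the left factor is unfolded below; the one on the right
        factor is constant in the inner sum, so the sum is pulled back through the left slot of the
        tensor.\<close>
      also have "\<dots> = ?L (\<lambda>a b. ?L (\<lambda>c d. ?L (\<lambda>i j. ?q (?act (?p a c) i) (?act (?p b d) j))
          (\<Delta>\<^sub>H g)) (\<Delta>\<^sub>X y)) (\<Delta>\<^sub>X x)"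
        apply (rule X.sweedler_cong[OF x], rule X.sweedler_cong[OF y], rule H.sweedler_cong[OF g])
        apply (subst (2) diagonal_action_pure, assumption+)
        apply (rule H.sweedler_hom[symmetric, OF _ _ bilinear_mapD2[OF bilinear_pure_tensor]], (assumption | rule intros)+)
        done
      also have "\<dots> = ?L (\<lambda>u v. ?L (\<lambda>g\<^sub>1 g\<^sub>2. ?q (?act u g\<^sub>1) (?act v g\<^sub>2)) (\<Delta>\<^sub>H g)) (?D (?p x y))"
        by (rule X.sweedler_tensor[symmetric]) (assumption | rule intros)+
      finally show "?D (?act (?p x y) g)
        = ?L (\<lambda>u v. ?L (\<lambda>g\<^sub>1 g\<^sub>2. ?q (?act u g\<^sub>1) (?act v g\<^sub>2)) (\<Delta>\<^sub>H g)) (?D (?p x y))" .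
    qed (assumption | rule g intros)+
    \<comment> \<open>Instantiating the definition at \<open>?Y\<close> unfolds the diagonal action
      on the square of \<open>?Y\<close> alone and keeps \<open>?act\<close> folded.\<close>
    then show "?D (?act z g) = diagonal_action K ?Y \<Delta>\<^sub>H ?act (?D z) g"
      by (simp only: diagonal_action_def[of K ?Y])
  qed
qed

end

section \<open>The augmentation map of the tensor square\<close>

context categorical_augmented_rack
begin

lemma tensor_augmentation_linear: "tensor_augmentation K H \<nu> \<in> linear_maps K (tensor K X X) H"
  unfolding tensor_augmentation_def comp_def
  by (rule linear_maps_comp[OF tensor_map_linear tensor_lift_linear])
    (assumption | rule aug_linear multilinear_intros rack_intros)+

lemma tensor_augmentation_pure:
  "x \<in> carrier X \<Longrightarrow> y \<in> carrier X \<Longrightarrow>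
    tensor_augmentation K H \<nu> (pure_tensor K X X x y) = \<nu> x \<otimes>\<^bsub>H\<^esub> \<nu> y"
  unfolding tensor_augmentation_def
  by (simp add: tensor_map_pure[OF _ _ _ _ aug_linear aug_linear] X.module_axioms H.module_axioms
      tensor_lift_pure[OF _ _ _ H.mult_bilinear] aug_closed)

text \<open>That the augmentation is a coalgebra morphism follows from multiplicativity of
  \<open>\<Delta>\<^sub>H\<close>: the product multiplies first legs with first legs and second with
  second, which is the pairing made by the middle flip. The augmentation rule follows from the
  crossed relation, \<open>h1 \<nu>(x h2) \<nu>(y h3) = \<nu>(x) h1 \<nu>(y h2) = \<nu>(x) \<nu>(y)
  h\<close>.\<close>

lemma tensor_square_rack:
  assumes cc: "cocommutative K H \<Delta>\<^sub>H"
  shows "categorical_augmented_rack K H \<Delta>\<^sub>H \<epsilon>\<^sub>H S (tensor K X X) (tensor_comult K X \<Delta>\<^sub>X) (tensor_counit K \<epsilon>\<^sub>X)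
    (diagonal_action K X \<Delta>\<^sub>H act) (tensor_augmentation K H \<nu>)"
proof -
  let ?Y = "tensor K X X"
  let ?D = "tensor_comult K X \<Delta>\<^sub>X"
  let ?act = "diagonal_action K X \<Delta>\<^sub>H act"
  let ?\<nu> = "tensor_augmentation K H \<nu>"
  let ?p = "pure_tensor K X X"
  let ?HH = "tensor K H H"
  note X = X.module_axioms X.module_axioms
  note intros = multilinear_intros rack_intros diagonal_intros
    linear_maps_comp[OF _ tensor_augmentation_linear] linear_maps_closed[OF tensor_augmentation_linear]
  interpret Y: module K ?Y by (rule intros)+
  show ?thesis
  proof (intro categorical_augmented_rack.intro categorical_augmented_rack_axioms.intro
      tensor_square_module_coalgebra cc tensor_augmentation_linear)
    fix z assume z: "z \<in> carrier ?Y"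
    show "\<Delta>\<^sub>H (?\<nu> z) = tensor_map K H H ?\<nu> ?\<nu> (?D z)"
      unfolding tensor_map_def
    proof (rule tensor_ext[OF X _ _ _ z])
      fix x y assume x: "x \<in> carrier X" and y: "y \<in> carrier X"
      note intros = x y intros
      have "\<Delta>\<^sub>H (?\<nu> (?p x y)) = tensor_lift K ?HH (\<lambda>a b. tensor_lift K ?HH
          (\<lambda>c d. pure_tensor K H H (a \<otimes>\<^bsub>H\<^esub> c) (b \<otimes>\<^bsub>H\<^esub> d)) (\<Delta>\<^sub>H (\<nu> y))) (\<Delta>\<^sub>H (\<nu> x))"
        by (simp add: tensor_augmentation_pure x y aug_closed H.comult_mult)
      also have "\<dots> = tensor_lift K ?HH (\<lambda>a b. tensor_lift K ?HH
          (\<lambda>c d. pure_tensor K H H (\<nu> a \<otimes>\<^bsub>H\<^esub> c) (\<nu> b \<otimes>\<^bsub>H\<^esub> d)) (\<Delta>\<^sub>H (\<nu> y))) (\<Delta>\<^sub>X x)"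
        by (rule sweedler_aug) (assumption | rule intros)+
      also have "\<dots> = tensor_lift K ?HH (\<lambda>a b. tensor_lift K ?HH
          (\<lambda>c d. pure_tensor K H H (\<nu> a \<otimes>\<^bsub>H\<^esub> \<nu> c) (\<nu> b \<otimes>\<^bsub>H\<^esub> \<nu> d)) (\<Delta>\<^sub>X y)) (\<Delta>\<^sub>X x)"
        by (rule X.sweedler_cong[OF x], rule sweedler_aug) (assumption | rule intros)+
      also have "\<dots> = tensor_lift K ?HH (\<lambda>a b. tensor_lift K ?HH
          (\<lambda>c d. pure_tensor K H H (?\<nu> (?p a c)) (?\<nu> (?p b d))) (\<Delta>\<^sub>X y)) (\<Delta>\<^sub>X x)"
        by (simp add: tensor_augmentation_pure x y cong: X.sweedler_cong)
      also have "\<dots> = tensor_lift K ?HH (\<lambda>u v. pure_tensor K H H (?\<nu> u) (?\<nu> v)) (?D (?p x y))"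
        by (rule X.sweedler_tensor[symmetric]) (assumption | rule intros)+
      finally show "\<Delta>\<^sub>H (?\<nu> (?p x y))
        = tensor_lift K ?HH (\<lambda>u v. pure_tensor K H H (?\<nu> u) (?\<nu> v)) (?D (?p x y))" .
    qed (assumption | rule intros)+
    fix g assume g: "g \<in> carrier H"
    show "?\<nu> (?act z g) = tensor_lift K H (\<lambda>a b. S a \<otimes>\<^bsub>H\<^esub> ?\<nu> z \<otimes>\<^bsub>H\<^esub> b) (\<Delta>\<^sub>H g)"
    \<comment> \<open>Besides removing the antipode, the crossed form is linear in \<open>z\<close>,
      so it is enough to check it on pure tensors for a fixed \<open>h\<close>.\<close>
    proof (rule H.conjugation_of_crossed[OF _ _ g])
      show "(\<lambda>h. ?\<nu> (?act z h)) \<in> linear_maps K H H" "?\<nu> z \<in> carrier H"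
        by (assumption | rule z intros)+
      fix h assume h: "h \<in> carrier H"
      show "tensor_lift K H (\<lambda>a b. a \<otimes>\<^bsub>H\<^esub> ?\<nu> (?act z b)) (\<Delta>\<^sub>H h) = ?\<nu> z \<otimes>\<^bsub>H\<^esub> h"
      proof (rule tensor_ext[OF X _ _ _ z])
        fix x y assume x: "x \<in> carrier X" and y: "y \<in> carrier X"
        note intros = x y h intros
        have act: "?\<nu> (?act (?p x y) b) = tensor_lift K H (\<lambda>c d. \<nu> (act x c) \<otimes>\<^bsub>H\<^esub> \<nu> (act y d)) (\<Delta>\<^sub>H b)"
          if "b \<in> carrier H" for b
        proof -
          have "?\<nu> (?act (?p x y) b) = tensor_lift K H (\<lambda>c d. ?\<nu> (?p (act x c) (act y d))) (\<Delta>\<^sub>H b)"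
            unfolding diagonal_action_pure[OF x y that]
            by (rule H.sweedler_hom[OF _ _ tensor_augmentation_linear]) (assumption | rule that intros)+
          also have "\<dots> = tensor_lift K H (\<lambda>c d. \<nu> (act x c) \<otimes>\<^bsub>H\<^esub> \<nu> (act y d)) (\<Delta>\<^sub>H b)"
            by (simp add: tensor_augmentation_pure x y that act_closed cong: H.sweedler_cong)
          finally show ?thesis .
        qed
        have "tensor_lift K H (\<lambda>a b. a \<otimes>\<^bsub>H\<^esub> ?\<nu> (?act (?p x y) b)) (\<Delta>\<^sub>H h)
            = tensor_lift K H (\<lambda>a b. tensor_lift K H (\<lambda>c d. a \<otimes>\<^bsub>H\<^esub> (\<nu> (act x c) \<otimes>\<^bsub>H\<^esub> \<nu> (act y d))) (\<Delta>\<^sub>H b)) (\<Delta>\<^sub>H h)"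
          by (rule H.sweedler_cong[OF h], simp only: act,
              rule H.sweedler_hom[OF _ _ bilinear_mapD1[OF H.mult_bilinear]]) (assumption | rule intros)+
        \<comment> \<open>Regrouping joins the free leg of \<open>h\<close> to the leg acting on
          \<open>x\<close>, so that the crossed relation for \<open>x\<close> applies to the inner
          sum and releases a leg for \<open>y\<close>.\<close>
        also have "\<dots> = tensor_lift K H (\<lambda>a b. tensor_lift K H (\<lambda>c d. c \<otimes>\<^bsub>H\<^esub> (\<nu> (act x d) \<otimes>\<^bsub>H\<^esub> \<nu> (act y b))) (\<Delta>\<^sub>H a)) (\<Delta>\<^sub>H h)"
          by (rule H.sweedler_coassoc[OF _ h, symmetric,
                where T = "\<lambda>a c d. a \<otimes>\<^bsub>H\<^esub> (\<nu> (act x c) \<otimes>\<^bsub>H\<^esub> \<nu> (act y d))"])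
            (assumption | rule intros)+
        also have "\<dots> = tensor_lift K H (\<lambda>a b. tensor_lift K H (\<lambda>c d. c \<otimes>\<^bsub>H\<^esub> \<nu> (act x d) \<otimes>\<^bsub>H\<^esub> \<nu> (act y b)) (\<Delta>\<^sub>H a)) (\<Delta>\<^sub>H h)"
          by (simp add: H.H.m_assoc x y h act_closed aug_closed cong: H.sweedler_cong)
        also have "\<dots> = tensor_lift K H (\<lambda>a b. tensor_lift K H (\<lambda>c d. c \<otimes>\<^bsub>H\<^esub> \<nu> (act x d)) (\<Delta>\<^sub>H a) \<otimes>\<^bsub>H\<^esub> \<nu> (act y b)) (\<Delta>\<^sub>H h)"
          by (rule H.sweedler_cong[OF h], rule H.sweedler_hom[symmetric, OF _ _ bilinear_mapD2[OF H.mult_bilinear]])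
            (assumption | rule intros)+
        also have "\<dots> = tensor_lift K H (\<lambda>a b. \<nu> x \<otimes>\<^bsub>H\<^esub> (a \<otimes>\<^bsub>H\<^esub> \<nu> (act y b))) (\<Delta>\<^sub>H h)"
          by (rule H.sweedler_cong[OF h]) (simp add: crossed x y H.H.m_assoc act_closed aug_closed)
        also have "\<dots> = \<nu> x \<otimes>\<^bsub>H\<^esub> tensor_lift K H (\<lambda>a b. a \<otimes>\<^bsub>H\<^esub> \<nu> (act y b)) (\<Delta>\<^sub>H h)"
          by (rule H.sweedler_hom[symmetric, OF _ _ bilinear_mapD1[OF H.mult_bilinear]])
            (assumption | rule intros)+
        also have "\<dots> = ?\<nu> (?p x y) \<otimes>\<^bsub>H\<^esub> h"
          by (simp add: crossed tensor_augmentation_pure x y h H.H.m_assoc aug_closed)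
        finally show "tensor_lift K H (\<lambda>a b. a \<otimes>\<^bsub>H\<^esub> ?\<nu> (?act (?p x y) b)) (\<Delta>\<^sub>H h) = ?\<nu> (?p x y) \<otimes>\<^bsub>H\<^esub> h" .
      qed (assumption | rule h intros)+
    qed
  qed
qed

end

theorem theorem6p2:
  fixes K :: "('k, 'r) ring_scheme" and H :: "('k, 'h, 'm) module_scheme"
    and X :: "('k, 'x, 'n) module_scheme"
  assumes "categorical_augmented_rack K H \<Delta>\<^sub>H \<epsilon>\<^sub>H S X \<Delta>\<^sub>X \<epsilon>\<^sub>X act \<nu>"
    and "cocommutative K H \<Delta>\<^sub>H"
    and "Y = tensor K X X"
    and "\<Delta>\<^sub>Y = tensor_comult K X \<Delta>\<^sub>X"
    and "act\<^sub>Y = diagonal_action K X \<Delta>\<^sub>H act"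
    and "\<nu>\<^sub>Y = tensor_augmentation K H \<nu>"
    and "R = rack_R_matrix K Y \<Delta>\<^sub>Y act\<^sub>Y \<nu>\<^sub>Y"
  shows "yang_baxter K Y R"
  unfolding assms(3-7)
  by (rule categorical_augmented_rack.yang_baxter_R_matrix
      [OF categorical_augmented_rack.tensor_square_rack[OF assms(1,2)] assms(2)])

end
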